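(* Let $\alpha,\beta\in\{1,2,3\}$ and $p=(p_1,p_2,p_3),\,q=(q_1,q_2,q_3)\in\mathbb{C}^3$. Let $\pi^2_{jk}:\mathbf{U}(2)\to\mathbb{C}$ ($1\le j,k\le 3$) be the entries of the matrix $$ \pi^2=\begin{bmatrix} z_{11}^2 & z_{11}z_{12} & z_{12}^2\\ 2z_{11}z_{21} & z_{11}z_{22}+z_{12}z_{21} & 2z_{12}z_{22}\\ z_{21}^2 & z_{21}z_{22} & z_{22}^2 \end{bmatrix}, $$ where $z_{ij}$ are the matrix entries of $z\in\mathbf{U}(2)$, and define $P,Q:\mathbf{U}(2)\to\mathbb{C}$ by $$ P(z)=\sum_{j=1}^3 p_j\,\pi^2_{j\alpha}(z),\qquad Q(z)=\sum_{k=1}^3 q_k\,\pi^2_{k\beta}(z). $$ Let the rational function $f(z)=P(z)/Q(z)$ be defined on the open and dense subset $W_Q=\{z\in\mathbf{U}(2)\mid Q(z)\neq 0\}$ of $\mathbf{U}(2)$. If $\alpha\neq\beta$, then $f$ is proper biharmonic whenever $p_2q_3-p_3q_2\neq 0$ and $$ p_1q_3^2=q_2(2p_2q_3-p_3q_2),\qquad q_1q_3=q_2^2 . $$ The corresponding statement holds for the function induced on $\mathbf{SU}(2)$: under the same conditions, the restriction of $f$ to $W_Q\cap\mathbf{SU}(2)$ is proper biharmonic.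
   Context: $\mathbf{U}(2)=\{z\in\mathbf{GL}_2(\mathbb{C})\mid zz^*=I_2\}$ and $\mathbf{SU}(2)=\{z\in\mathbf{U}(2)\mid\det z=1\}$ carry the left-invariant Riemannian metrics induced by the scalar product $g(Z,W)=\mathrm{Re}\,\mathrm{trace}(ZW^* )$ on their Lie algebras (as subalgebras of $\mathfrak{gl}_2(\mathbb{C})$). For a complex-valued smooth function $f$ on a Riemannian manifold, $\tau(f)=\mathrm{div}(\nabla f)$ is the (complex-linearly extended) Laplace–Beltrami operator, $\tau^0(f)=f$ and $\tau^r(f)=\tau(\tau^{r-1}(f))$. The function $f$ is called proper biharmonic if $\tau^2(f)=0$ and $\tau(f)$ does not vanish identically. The function $f=P/Q$ is invariant under the circle action $z\mapsto e^{i\theta}z$ on $\mathbf{U}(2)$ (it is a quotient of homogeneous polynomials of the same degree in the $z_{ij}$), and the function induced on $\mathbf{SU}(2)$ is its restriction to $W_Q\cap\mathbf{SU}(2)$. *)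

theory Defs
  imports "HOL-Analysis.Analysis"
begin

section \<open>Unitary groups\<close>

definition adj :: "complex^'n^'n \<Rightarrow> complex^'n^'n" where
  "adj z = (\<chi> i j. cnj (z $ j $ i))"

definition unitary_group :: "(complex^'n^'n) set" where
  "unitary_group = {z. invertible z \<and> z ** adj z = mat 1}"

definition special_unitary_group :: "(complex^'n^'n) set" where
  "special_unitary_group = {z \<in> unitary_group. det z = 1}"

section \<open>Smooth functions\<close>

fun Ck_on :: "nat \<Rightarrow> ('a::real_normed_vector \<Rightarrow> 'b::real_normed_vector) \<Rightarrow> 'a set \<Rightarrow> bool" where
  "Ck_on 0 F S = continuous_on S F"
| "Ck_on (Suc k) F S =
     (\<exists>F'. (\<forall>x\<in>S. (F has_derivative F' x) (at x)) \<and> (\<forall>v. Ck_on k (\<lambda>x. F' x v) S))"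

text \<open>
  A function on a subset of a submanifold of the matrix space is smooth if it is locally the
  restriction of a smooth function of the ambient space.
\<close>

definition smooth_fun_on :: "('a::real_normed_vector) set \<Rightarrow> ('a \<Rightarrow> 'b::real_normed_vector) \<Rightarrow> bool" where
  "smooth_fun_on W f \<longleftrightarrow>
     (\<forall>z\<in>W. \<exists>S F. open S \<and> z \<in> S \<and> (\<forall>k. Ck_on k F S) \<and> (\<forall>w\<in>W \<inter> S. F w = f w))"

section \<open>Left-invariant Riemannian metric on a matrix Lie group\<close>

text \<open>
  Throughout, \<open>G\<close> is a closed subgroup of \<open>GL\<^sub>n(\<complex>)\<close>. Its tangent spaces are realised as real
  subspaces of the space of matrices (velocities of curves in \<open>G\<close>), so that \<open>T\<^sub>z G = z \<cdot> T\<^sub>1 G\<close>.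
  Functions and vector fields on (open subsets of) \<open>G\<close> are represented by functions on all
  matrices, of which only the values on \<open>G\<close> are used.
\<close>

definition tangent_space :: "(complex^'n^'n) set \<Rightarrow> complex^'n^'n \<Rightarrow> (complex^'n^'n) set" where
  "tangent_space G z =
     {v. \<exists>\<gamma>::real \<Rightarrow> complex^'n^'n. (\<forall>t. \<gamma> t \<in> G) \<and> \<gamma> 0 = z \<and> (\<gamma> has_vector_derivative v) (at 0)}"

definition lie_algebra :: "(complex^'n^'n) set \<Rightarrow> (complex^'n^'n) set" where
  "lie_algebra G = tangent_space G (mat 1)"

definition scalar_prod :: "complex^'n^'n \<Rightarrow> complex^'n^'n \<Rightarrow> real" where
  "scalar_prod Z W = Re (trace (Z ** adj W))"

definition metric :: "complex^'n^'n \<Rightarrow> complex^'n^'n \<Rightarrow> complex^'n^'n \<Rightarrow> real" where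
  "metric z v w = scalar_prod (matrix_inv z ** v) (matrix_inv z ** w)"

text \<open>
  The differential of \<open>f\<close> at \<open>z\<close> is the restriction of \<open>frechet_derivative f (at z within G)\<close> to
  \<open>tangent_space G z\<close>; the choice in \<^const>\<open>frechet_derivative\<close> does not matter there, since all
  derivatives within \<open>G\<close> agree on velocities of curves in \<open>G\<close>.
\<close>

definition grad :: "(complex^'n^'n) set \<Rightarrow> (complex^'n^'n \<Rightarrow> real) \<Rightarrow> complex^'n^'n \<Rightarrow> complex^'n^'n" where
  "grad G f z = (THE v. v \<in> tangent_space G z \<and>
     (\<forall>w\<in>tangent_space G z. metric z v w = frechet_derivative f (at z within G) w))"

text \<open>
  For left-invariant fields \<open>X\<close>, \<open>Y\<close> the Levi-Civita derivative of \<open>Y\<close> along \<open>X\<close> is again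
  left-invariant, so it is given by a bilinear map on the Lie algebra. As \<open>g(X,Y)\<close> is constant
  for such fields, the conditions on this map are vanishing torsion and compatibility with the
  metric; they determine it uniquely on the Lie algebra (its values elsewhere are irrelevant).
\<close>

definition is_levi_civita ::
  "(complex^'n^'n) set \<Rightarrow> (complex^'n^'n \<Rightarrow> complex^'n^'n \<Rightarrow> complex^'n^'n) \<Rightarrow> bool" where
  "is_levi_civita G \<Gamma> \<longleftrightarrow> bilinear \<Gamma> \<and>
     (\<forall>X\<in>lie_algebra G. \<forall>Y\<in>lie_algebra G.
        \<Gamma> X Y \<in> lie_algebra G \<and> \<Gamma> X Y - \<Gamma> Y X = X ** Y - Y ** X) \<and>
     (\<forall>X\<in>lie_algebra G. \<forall>Y\<in>lie_algebra G. \<forall>Z\<in>lie_algebra G.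
        scalar_prod (\<Gamma> X Y) Z + scalar_prod Y (\<Gamma> X Z) = 0)"

definition levi_civita ::
  "(complex^'n^'n) set \<Rightarrow> complex^'n^'n \<Rightarrow> complex^'n^'n \<Rightarrow> complex^'n^'n" where
  "levi_civita G = (SOME \<Gamma>. is_levi_civita G \<Gamma>)"

text \<open>
  A tangent vector field \<open>V\<close> is written as \<open>V w = w \<cdot> \<xi> w\<close> with \<open>\<xi>\<close> taking values in the Lie algebra,
  that is, as a combination of left-invariant fields with function coefficients. The Leibniz rule
  then gives the covariant derivative of \<open>V\<close> at \<open>z\<close> in the direction \<open>v\<close> as
  \<open>z \<cdot> (d\<xi>\<^sub>z(v) + \<Gamma> (z\<^sup>-\<^sup>1 v) (\<xi> z))\<close>.
\<close>

definition cov_deriv ::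
  "(complex^'n^'n) set \<Rightarrow> (complex^'n^'n \<Rightarrow> complex^'n^'n) \<Rightarrow> complex^'n^'n \<Rightarrow> complex^'n^'n \<Rightarrow> complex^'n^'n" where
  "cov_deriv G V z v =
     z ** (frechet_derivative (\<lambda>w. matrix_inv w ** V w) (at z within G) v
           + levi_civita G (matrix_inv z ** v) (matrix_inv z ** V z))"

definition orthonormal_basis_at ::
  "(complex^'n^'n) set \<Rightarrow> complex^'n^'n \<Rightarrow> (complex^'n^'n) set \<Rightarrow> bool" where
  "orthonormal_basis_at G z B \<longleftrightarrow> finite B \<and> span B = tangent_space G z \<and>
     (\<forall>e\<in>B. \<forall>e'\<in>B. metric z e e' = (if e = e' then 1 else 0))"

text \<open>The trace of \<open>v \<mapsto> cov_deriv G V z v\<close> on the tangent space; it is independent of the basis.\<close>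

definition divergence :: "(complex^'n^'n) set \<Rightarrow> (complex^'n^'n \<Rightarrow> complex^'n^'n) \<Rightarrow> complex^'n^'n \<Rightarrow> real" where
  "divergence G V z = (\<Sum>e \<in> (SOME B. orthonormal_basis_at G z B). metric z (cov_deriv G V z e) e)"

definition laplace_beltrami_real ::
  "(complex^'n^'n) set \<Rightarrow> (complex^'n^'n \<Rightarrow> real) \<Rightarrow> complex^'n^'n \<Rightarrow> real" where
  "laplace_beltrami_real G f = divergence G (grad G f)"

definition laplace_beltrami ::
  "(complex^'n^'n) set \<Rightarrow> (complex^'n^'n \<Rightarrow> complex) \<Rightarrow> complex^'n^'n \<Rightarrow> complex" where
  "laplace_beltrami G f z =
     Complex (laplace_beltrami_real G (\<lambda>w. Re (f w)) z) (laplace_beltrami_real G (\<lambda>w. Im (f w)) z)"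

text \<open>
  Here \<open>W\<close> is the domain of \<open>f\<close>, an open submanifold of \<open>G\<close>. The value of the Laplace-Beltrami
  operator at a point of \<open>W\<close> only depends on \<open>f\<close> near this point, hence only on \<open>f\<close> restricted to \<open>W\<close>.
\<close>

definition proper_biharmonic_on ::
  "(complex^'n^'n) set \<Rightarrow> (complex^'n^'n) set \<Rightarrow> (complex^'n^'n \<Rightarrow> complex) \<Rightarrow> bool" where
  "proper_biharmonic_on G W f \<longleftrightarrow>
     openin (top_of_set G) W \<and> smooth_fun_on W f \<and>
     (\<forall>z\<in>W. (laplace_beltrami G ^^ 2) f z = 0) \<and>
     (\<exists>z\<in>W. laplace_beltrami G f z \<noteq> 0)"

section \<open>The matrix of quadratic functions\<close>

definition pi2 :: "complex^2^2 \<Rightarrow> complex^3^3" where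
  "pi2 z = vector
     [vector [(z $ 1 $ 1)\<^sup>2,           z $ 1 $ 1 * z $ 1 $ 2,                         (z $ 1 $ 2)\<^sup>2],
      vector [2 * z $ 1 $ 1 * z $ 2 $ 1, z $ 1 $ 1 * z $ 2 $ 2 + z $ 1 $ 2 * z $ 2 $ 1, 2 * z $ 1 $ 2 * z $ 2 $ 2],
      vector [(z $ 2 $ 1)\<^sup>2,           z $ 2 $ 1 * z $ 2 $ 2,                         (z $ 2 $ 2)\<^sup>2]]"

end

theory Submission
  imports Defs
begin

text \<open>
  The metric is bi-invariant, so on functions the Laplace-Beltrami operator is the sum of the
  squares of the left-invariant fields belonging to an orthonormal basis of the Lie algebra.

  The conditions on \<open>p\<close> and \<open>q\<close> force \<open>q = q\<^sub>3 (t\<^sup>2, t, 1)\<close> and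
  \<open>p = p\<^sub>3 (t\<^sup>2, t, 1) + c (2t, 1, 0)\<close> with \<open>c \<noteq> 0\<close>. With \<open>u\<close>, \<open>v\<close> the entries of the row
  \<open>(t, 1) z\<close> and \<open>a\<close>, \<open>b\<close> those of the first row of \<open>z\<close>, the columns of \<open>\<pi>\<^sup>2\<close> are then mapped to
  \<open>u\<^sup>2\<close>, \<open>u v\<close>, \<open>v\<^sup>2\<close> and to \<open>2 a u\<close>, \<open>a v + b u\<close>, \<open>2 b v\<close>. Hence, up to exchanging the columns, \<open>f\<close>
  is a polynomial in \<open>x = v / u\<close>, \<open>y = b / u\<close> and \<open>d = (a v - b u) / u\<^sup>2\<close>. Here
  \<open>x\<close>, \<open>x\<^sup>2\<close>, \<open>d\<close>, \<open>x d\<close> are harmonic while \<open>\<tau>(y) = 2 d\<close> and \<open>\<tau>(x y) = 4 x d\<close>, and exactly one of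
  \<open>y\<close>, \<open>x y\<close> occurs in \<open>f\<close>. All these functions are invariant under scalars, so the same computation
  serves both groups.
\<close>

section \<open>Closure properties of smooth functions\<close>

text \<open>The product rule keeps undifferentiated factors, so inductions over \<open>k\<close> on
  products have to step down one order.\<close>

lemma Ck_on_mono_Suc: "Ck_on (Suc k) F S \<Longrightarrow> Ck_on k F S"
proof (induction k arbitrary: F)
  case 0
  then show ?case
    by (auto intro!: continuous_at_imp_continuous_on dest: has_derivative_continuous)
next
  case (Suc k)
  then show ?case
    by (metis Ck_on.simps(2))
qed

lemma Ck_on_const: "Ck_on k (\<lambda>x. c) S"
proof (induction k arbitrary: c)
  case (Suc k)
  have "\<forall>x\<in>S. ((\<lambda>x. c) has_derivative (\<lambda>v. 0)) (at x)"
    by auto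
  with Suc show ?case
    unfolding Ck_on.simps by (intro exI[of _ "\<lambda>_ _. 0"]) blast
qed auto

lemma Ck_on_bounded_linear:
  assumes "bounded_linear F"
  shows "Ck_on k F S"
proof (cases k)
  case 0
  then show ?thesis
    using assms by (simp add: linear_continuous_on)
next
  case (Suc n)
  have "\<forall>x\<in>S. (F has_derivative F) (at x)"
    using assms by (simp add: bounded_linear_imp_has_derivative)
  then show ?thesis
    unfolding Suc Ck_on.simps by (intro exI[of _ "\<lambda>_. F"]) (simp add: Ck_on_const)
qed

lemma Ck_on_add:
  assumes "Ck_on k F S" "Ck_on k G S"
  shows "Ck_on k (\<lambda>x. F x + G x) S"
  using assms
proof (induction k arbitrary: F G)
  case 0
  then show ?case
    by (auto intro: continuous_on_add)
next
  case (Suc k)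
  obtain F' where F': "\<forall>x\<in>S. (F has_derivative F' x) (at x)" "\<forall>v. Ck_on k (\<lambda>x. F' x v) S"
    using Suc.prems by auto
  obtain G' where G': "\<forall>x\<in>S. (G has_derivative G' x) (at x)" "\<forall>v. Ck_on k (\<lambda>x. G' x v) S"
    using Suc.prems by auto
  show ?case
    unfolding Ck_on.simps
  proof (intro exI[of _ "\<lambda>x v. F' x v + G' x v"] conjI ballI allI)
    show "((\<lambda>x. F x + G x) has_derivative (\<lambda>v. F' x v + G' x v)) (at x)" if "x \<in> S" for x
      using F' G' that by (intro has_derivative_add) auto
  qed (use F' G' Suc.IH in auto)
qed

lemma Ck_on_mult:
  fixes F G :: "'a::real_normed_vector \<Rightarrow> 'b::real_normed_algebra"
  assumes "Ck_on k F S" "Ck_on k G S"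
  shows "Ck_on k (\<lambda>x. F x * G x) S"
  using assms
proof (induction k arbitrary: F G)
  case 0
  then show ?case
    by (auto intro: continuous_on_mult)
next
  case (Suc k)
  obtain F' where F': "\<forall>x\<in>S. (F has_derivative F' x) (at x)" "\<forall>v. Ck_on k (\<lambda>x. F' x v) S"
    using Suc.prems by auto
  obtain G' where G': "\<forall>x\<in>S. (G has_derivative G' x) (at x)" "\<forall>v. Ck_on k (\<lambda>x. G' x v) S"
    using Suc.prems by auto
  have FG: "Ck_on k F S" "Ck_on k G S"
    using Suc.prems by (blast intro: Ck_on_mono_Suc)+
  show ?case
    unfolding Ck_on.simps
  proof (intro exI[of _ "\<lambda>x v. F x * G' x v + F' x v * G x"] conjI ballI allI)
    show "((\<lambda>x. F x * G x) has_derivative (\<lambda>v. F x * G' x v + F' x v * G x)) (at x)" if "x \<in> S" for x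
      using F' G' that by (intro has_derivative_mult) auto
    show "Ck_on k (\<lambda>x. F x * G' x v + F' x v * G x) S" for v
      using F' G' FG by (intro Ck_on_add Suc.IH) auto
  qed
qed

lemma Ck_on_inverse:
  fixes F :: "'a::real_normed_vector \<Rightarrow> 'b::real_normed_div_algebra"
  assumes "Ck_on k F S" and nz: "\<forall>x\<in>S. F x \<noteq> 0"
  shows "Ck_on k (\<lambda>x. inverse (F x)) S"
  using assms(1)
proof (induction k)
  case 0
  then show ?case
    using nz by (auto intro: continuous_on_inverse)
next
  case (Suc k)
  obtain F' where F': "\<forall>x\<in>S. (F has_derivative F' x) (at x)" "\<forall>v. Ck_on k (\<lambda>x. F' x v) S"
    using Suc.prems by auto
  have IH: "Ck_on k (\<lambda>x. inverse (F x)) S"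
    using Suc by (blast intro: Ck_on_mono_Suc)
  show ?case
    unfolding Ck_on.simps
  \<comment> \<open>The minus sign is written as the constant factor \<open>- 1\<close>, so that
    closure under products and constants suffices.\<close>
  proof (intro exI[of _ "\<lambda>x v. - 1 * (inverse (F x) * F' x v * inverse (F x))"] conjI ballI allI)
    show "((\<lambda>x. inverse (F x)) has_derivative (\<lambda>v. - 1 * (inverse (F x) * F' x v * inverse (F x)))) (at x)"
      if "x \<in> S" for x
      using F' that nz by (auto intro!: has_derivative_eq_rhs[OF has_derivative_inverse])
    show "Ck_on k (\<lambda>x. - 1 * (inverse (F x) * F' x v * inverse (F x))) S" for v
      using F' IH by (intro Ck_on_mult Ck_on_const) auto
  qed
qed

section \<open>The Laplace-Beltrami operator as a sum of squares\<close>

lemma bilinear_matrix_mult: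
  "bilinear ((**) :: complex^'n^'n \<Rightarrow> complex^'n^'n \<Rightarrow> complex^'n^'n)"
  unfolding bilinear_def
  by (auto intro!: linearI simp: matrix_matrix_mult_def vec_eq_iff sum.distrib
      distrib_left distrib_right scaleR_sum_right)

lemmas bounded_bilinear_matrix_mult = bilinear_matrix_mult[unfolded bilinear_conv_bounded_bilinear]

interpretation matrix_mult: bounded_bilinear
  "(**) :: complex^'n^'n \<Rightarrow> complex^'n^'n \<Rightarrow> complex^'n^'n"
  by (rule bounded_bilinear_matrix_mult)

lemma adj_mult: "adj (X ** Y) = adj Y ** adj X"
  by (simp add: adj_def matrix_matrix_mult_def vec_eq_iff mult.commute)

lemma adj_adj [simp]: "adj (adj X) = X"
  by (simp add: adj_def vec_eq_iff)

lemma adj_mat_1 [simp]: "adj (mat 1) = mat 1"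
  by (auto simp: adj_def mat_def vec_eq_iff)

lemma linear_adj: "linear (adj :: complex^'n^'n \<Rightarrow> _)"
  by (rule linearI) (simp_all add: adj_def vec_eq_iff)

lemmas bounded_linear_adj = linear_adj[unfolded linear_conv_bounded_linear]

text \<open>\<open>Re (z * cnj w)\<close> is the inner product of \<open>complex\<close> as a real
  plane, so the metric at the identity is the Euclidean one on matrices, and facts on orthonormal
  sets apply.\<close>

lemma scalar_prod_eq_inner: "scalar_prod Z W = Z \<bullet> W"
  by (simp add: scalar_prod_def trace_def adj_def matrix_matrix_mult_def inner_vec_def inner_complex_def)

lemma unitary_iff: "z \<in> unitary_group \<longleftrightarrow> z ** adj z = mat 1"
  unfolding unitary_group_def invertible_def using matrix_left_right_inverse by blast

lemma unitary_adj_mult: "z \<in> unitary_group \<Longrightarrow> adj z ** z = mat 1"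
  using unitary_iff matrix_left_right_inverse by blast

lemma matrix_inv_unitary:
  assumes "z \<in> unitary_group"
  shows "matrix_inv z = adj z"
proof -
  have "z ** matrix_inv z = mat 1 \<and> matrix_inv z ** z = mat 1"
    unfolding matrix_inv_def
    by (rule someI[of _ "adj z"]) (use assms unitary_iff unitary_adj_mult in auto)
  then show ?thesis
    by (metis assms matrix_mul_assoc matrix_mul_lid matrix_mul_rid unitary_adj_mult)
qed

lemma matrix_inv_cancel: "z \<in> unitary_group \<Longrightarrow> matrix_inv z ** (z ** X) = X"
  by (simp add: matrix_inv_unitary matrix_mul_assoc unitary_adj_mult)

lemma unitary_mult:
  assumes "z \<in> unitary_group" "w \<in> unitary_group"
  shows "z ** w \<in> unitary_group"
proof -
  have "z ** w ** adj (z ** w) = z ** (w ** adj w) ** adj z"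
    by (simp add: adj_mult matrix_mul_assoc)
  then show ?thesis
    using assms by (simp add: unitary_iff)
qed

lemma unitary_adj: "z \<in> unitary_group \<Longrightarrow> adj z \<in> unitary_group"
  by (simp add: unitary_iff unitary_adj_mult)

lemma mat_1_unitary: "mat 1 \<in> unitary_group"
  by (simp add: unitary_iff)

lemma metric_translate: "z \<in> unitary_group \<Longrightarrow> metric z (z ** X) (z ** Y) = X \<bullet> Y"
  by (simp add: metric_def matrix_inv_cancel scalar_prod_eq_inner)

text \<open>Differentiate \<open>\<gamma> t ** adj (\<gamma> t) = mat 1\<close> at
  \<open>0\<close>.\<close>

lemma lie_algebra_unitary_subset:
  assumes "G \<subseteq> unitary_group" "X \<in> lie_algebra G"
  shows "adj X = - X"
proof -
  obtain \<gamma> where \<gamma>: "\<forall>t. \<gamma> t \<in> G" "\<gamma> 0 = mat 1" "(\<gamma> has_vector_derivative X) (at 0)"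
    using assms(2) by (auto simp: lie_algebra_def tangent_space_def)
  have "((\<lambda>t. adj (\<gamma> t)) has_vector_derivative adj X) (at 0)"
    by (rule bounded_linear.has_vector_derivative[OF bounded_linear_adj \<gamma>(3)])
  from matrix_mult.has_vector_derivative[OF \<gamma>(3) this]
  have "((\<lambda>t. \<gamma> t ** adj (\<gamma> t)) has_vector_derivative adj X + X) (at 0)"
    by (simp add: \<gamma>(2))
  moreover have "(\<lambda>t. \<gamma> t ** adj (\<gamma> t)) = (\<lambda>t. mat 1)"
    using \<gamma>(1) assms(1) unitary_iff by blast
  ultimately have "((\<lambda>t::real. mat 1) has_vector_derivative adj X + X) (at 0)"
    by simp
  then have "adj X + X = 0"
    using vector_derivative_unique_at has_vector_derivative_const by blast
  then show ?thesis
    by (simp add: eq_neg_iff_add_eq_0)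
qed

text \<open>Derivatives within \<open>G\<close> need not be unique, but each sends the velocity
  \<open>v\<close> of a curve to the derivative of \<open>f\<close> along that curve, which is
  unique.\<close>

lemma frechet_derivative_tangent:
  fixes f :: "complex^'n^'n \<Rightarrow> 'b::real_normed_vector"
  assumes f: "(f has_derivative f') (at z within G)" and v: "v \<in> tangent_space G z"
  shows "frechet_derivative f (at z within G) v = f' v"
proof -
  obtain \<gamma> where \<gamma>: "\<forall>t. \<gamma> t \<in> G" "\<gamma> 0 = z" "(\<gamma> has_vector_derivative v) (at 0)"
    using v by (auto simp: tangent_space_def)
  have *: "((\<lambda>t. f (\<gamma> t)) has_vector_derivative g v) (at 0)"
    if "(f has_derivative g) (at z within G)" for g
  proof -
    have "(f has_derivative g) (at (\<gamma> 0) within range \<gamma>)"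
      using \<gamma> that by (auto intro: has_derivative_subset)
    from has_derivative_in_compose[OF \<gamma>(3)[unfolded has_vector_derivative_def] this]
    show ?thesis
      unfolding has_vector_derivative_def
      using linear_scale[OF has_derivative_linear[OF that]] by simp
  qed
  have "(f has_derivative frechet_derivative f (at z within G)) (at z within G)"
    using f frechet_derivative_works differentiable_def by blast
  from *[OF this] *[OF f] show ?thesis
    by (rule vector_derivative_unique_at)
qed

section \<open>Tangent spaces of a group of unitary matrices\<close>

locale unitary_matrix_group =
  fixes G :: "(complex^'n^'n) set"
  assumes subset_unitary: "G \<subseteq> unitary_group"
    and one_closed: "mat 1 \<in> G"
    and mult_closed: "\<And>z w. z \<in> G \<Longrightarrow> w \<in> G \<Longrightarrow> z ** w \<in> G"
    and adj_closed: "\<And>z. z \<in> G \<Longrightarrow> adj z \<in> G"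
begin

lemma unitary: "z \<in> G \<Longrightarrow> z \<in> unitary_group"
  using subset_unitary by blast

text \<open>Sums of velocities come from pointwise products of curves through the identity, real
  multiples from reparametrised curves.\<close>

lemma subspace_lie_algebra: "subspace (lie_algebra G)"
proof (rule subspaceI)
  show "0 \<in> lie_algebra G"
    unfolding lie_algebra_def tangent_space_def
    by (auto intro!: exI[of _ "\<lambda>_. mat 1"] one_closed)
next
  fix X Y assume "X \<in> lie_algebra G" "Y \<in> lie_algebra G"
  then obtain \<gamma> \<delta> where \<gamma>: "\<forall>t. \<gamma> t \<in> G" "\<gamma> 0 = mat 1" "(\<gamma> has_vector_derivative X) (at 0)"
    and \<delta>: "\<forall>t. \<delta> t \<in> G" "\<delta> 0 = mat 1" "(\<delta> has_vector_derivative Y) (at 0)"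
    by (auto simp: lie_algebra_def tangent_space_def)
  from matrix_mult.has_vector_derivative[OF \<gamma>(3) \<delta>(3)]
  have "((\<lambda>t. \<gamma> t ** \<delta> t) has_vector_derivative X + Y) (at 0)"
    by (simp add: \<gamma>(2) \<delta>(2) add.commute)
  then show "X + Y \<in> lie_algebra G"
    unfolding lie_algebra_def tangent_space_def using \<gamma> \<delta> mult_closed
    by (auto intro!: exI[of _ "\<lambda>t. \<gamma> t ** \<delta> t"])
next
  fix c :: real and X assume "X \<in> lie_algebra G"
  then obtain \<gamma> where \<gamma>: "\<forall>t. \<gamma> t \<in> G" "\<gamma> 0 = mat 1" "(\<gamma> has_vector_derivative X) (at 0)"
    by (auto simp: lie_algebra_def tangent_space_def)
  have "((\<lambda>t. c * t) has_vector_derivative c) (at 0)"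
    by (auto intro!: derivative_eq_intros)
  from vector_diff_chain_at[OF this, of \<gamma> X]
  have "((\<lambda>t. \<gamma> (c * t)) has_vector_derivative c *\<^sub>R X) (at 0)"
    using \<gamma>(3) by (simp add: o_def)
  then show "c *\<^sub>R X \<in> lie_algebra G"
    unfolding lie_algebra_def tangent_space_def using \<gamma>
    by (auto intro!: exI[of _ "\<lambda>t. \<gamma> (c * t)"])
qed

lemma translate_tangent:
  assumes "z \<in> G" "w \<in> G" "v \<in> tangent_space G w"
  shows "z ** v \<in> tangent_space G (z ** w)"
proof -
  obtain \<gamma> where \<gamma>: "\<forall>t. \<gamma> t \<in> G" "\<gamma> 0 = w" "(\<gamma> has_vector_derivative v) (at 0)"
    using assms by (auto simp: tangent_space_def)
  have "((\<lambda>t. z ** \<gamma> t) has_vector_derivative z ** v) (at 0)"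
    using bounded_linear.has_vector_derivative[OF matrix_mult.bounded_linear_right \<gamma>(3)] .
  then show ?thesis
    unfolding tangent_space_def using \<gamma> mult_closed assms
    by (auto intro!: exI[of _ "\<lambda>t. z ** \<gamma> t"])
qed

text \<open>Left translation by \<open>z\<close> gives one inclusion, left translation by its
  inverse \<open>adj z\<close> the other.\<close>

lemma tangent_space_eq:
  assumes "z \<in> G"
  shows "tangent_space G z = (**) z ` lie_algebra G"
proof
  show "(**) z ` lie_algebra G \<subseteq> tangent_space G z"
    using translate_tangent[OF assms one_closed] by (auto simp: lie_algebra_def)
  show "tangent_space G z \<subseteq> (**) z ` lie_algebra G"
  proof
    fix v assume "v \<in> tangent_space G z"
    from translate_tangent[OF adj_closed[OF assms] assms this]
    have "adj z ** v \<in> lie_algebra G"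
      by (simp add: lie_algebra_def unitary_adj_mult unitary assms)
    moreover have "v = z ** (adj z ** v)"
      using assms unitary[OF assms] by (simp add: matrix_mul_assoc unitary_iff)
    ultimately show "v \<in> (**) z ` lie_algebra G"
      by blast
  qed
qed

lemma adj_lie_algebra: "X \<in> lie_algebra G \<Longrightarrow> adj X = - X"
  using lie_algebra_unitary_subset subset_unitary by blast

end

text \<open>Multiplication by \<open>adj\<close> of a matrix is adjoint to multiplication by it on
  the same side; for the left side this is cyclicity of the trace. For skew-Hermitian matrices it
  expresses bi-invariance of the metric.\<close>

lemma inner_mult_swap:
  fixes X Y Z :: "complex^'n^'n"
  shows "(X ** Y) \<bullet> Z = Y \<bullet> (adj X ** Z)" "(X ** Y) \<bullet> Z = X \<bullet> (Z ** adj Y)"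
proof -
  have "trace (X ** Y ** adj Z) = trace (Y ** (adj Z ** X))"
    by (metis matrix_mul_assoc trace_mul_sym)
  then show "(X ** Y) \<bullet> Z = Y \<bullet> (adj X ** Z)"
    by (simp add: scalar_prod_def adj_mult flip: scalar_prod_eq_inner)
  show "(X ** Y) \<bullet> Z = X \<bullet> (Z ** adj Y)"
    by (simp add: scalar_prod_def adj_mult matrix_mul_assoc flip: scalar_prod_eq_inner)
qed

section \<open>Gradient, divergence and Laplacian in an orthonormal left-invariant frame\<close>

locale unitary_matrix_group_basis = unitary_matrix_group G
  for G :: "(complex^'n^'n) set" +
  fixes I :: "'i set" and e :: "'i \<Rightarrow> complex^'n^'n"
  assumes finite_I: "finite I"
    and span_basis: "span (e ` I) = lie_algebra G"
    and orthonormal: "\<And>i k. i \<in> I \<Longrightarrow> k \<in> I \<Longrightarrow> e i \<bullet> e k = (if i = k then 1 else 0)"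
    and bracket_closed: "\<And>X Y. X \<in> lie_algebra G \<Longrightarrow> Y \<in> lie_algebra G \<Longrightarrow>
      X ** Y - Y ** X \<in> lie_algebra G"
begin

lemma basis_in: "i \<in> I \<Longrightarrow> e i \<in> lie_algebra G"
  using span_base[of "e i" "e ` I"] by (simp add: span_basis)

lemma inj_basis: "inj_on e I"
  using orthonormal by (metis (no_types, lifting) inj_onI zero_neq_one)

lemma basis_expand:
  assumes "X \<in> lie_algebra G"
  shows "(\<Sum>i\<in>I. (X \<bullet> e i) *\<^sub>R e i) = X"
proof -
  have "(\<Sum>b\<in>e ` I. (X \<bullet> b) *\<^sub>R b) = X"
  proof (rule orthonormal_basis_expand)
    show "pairwise orthogonal (e ` I)"
      using orthonormal by (auto simp: pairwise_def orthogonal_def)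
  qed (use assms span_basis finite_I orthonormal in \<open>auto simp: norm_eq_1\<close>)
  then show ?thesis
    by (simp add: sum.reindex[OF inj_basis])
qed

text \<open>By bi-invariance of the metric, half the commutator is a Levi-Civita connection, so the
  \<open>SOME\<close> in the definition of \<^const>\<open>levi_civita\<close> is not taken over an empty predicate.\<close>

lemma levi_civita: "is_levi_civita G (levi_civita G)"
proof -
  have "is_levi_civita G (\<lambda>X Y. (1/2) *\<^sub>R (X ** Y - Y ** X))"
    unfolding is_levi_civita_def
  proof (intro conjI ballI)
    show "bilinear (\<lambda>X Y :: complex^'n^'n. (1/2) *\<^sub>R (X ** Y - Y ** X))"
      unfolding bilinear_def
      by (auto intro!: linearI simp: matrix_mult.add_left matrix_mult.add_right
          matrix_mult.scaleR_left matrix_mult.scaleR_right algebra_simps)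
  next
    fix X Y assume "X \<in> lie_algebra G" "Y \<in> lie_algebra G"
    then show "(1/2) *\<^sub>R (X ** Y - Y ** X) \<in> lie_algebra G"
      using bracket_closed subspace_scale[OF subspace_lie_algebra] by blast
    have "(1/2) *\<^sub>R A - (1/2) *\<^sub>R (- A) = A" for A :: "complex^'n^'n"
      by (simp add: scaleR_2[symmetric])
    from this[of "X ** Y - Y ** X"]
    show "(1/2) *\<^sub>R (X ** Y - Y ** X) - (1/2) *\<^sub>R (Y ** X - X ** Y) = X ** Y - Y ** X"
      by simp
  next
    fix X Y Z assume XYZ: "X \<in> lie_algebra G" "Y \<in> lie_algebra G" "Z \<in> lie_algebra G"
    have "(X ** Y) \<bullet> Z = - (Y \<bullet> (X ** Z))" "(Y ** X) \<bullet> Z = - (Y \<bullet> (Z ** X))"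
      using inner_mult_swap[of X Y Z] inner_mult_swap[of Y X Z] XYZ adj_lie_algebra
      by (simp_all add: matrix_mult.minus_left matrix_mult.minus_right)
    then show "scalar_prod ((1/2) *\<^sub>R (X ** Y - Y ** X)) Z
        + scalar_prod Y ((1/2) *\<^sub>R (X ** Z - Z ** X)) = 0"
      by (simp add: scalar_prod_eq_inner inner_diff_left inner_diff_right field_simps)
  qed
  then show ?thesis
    unfolding levi_civita_def by (rule someI[of "is_levi_civita G"])
qed

text \<open>Compatibility with the metric makes \<open>\<Gamma> Y X\<close> orthogonal to
  \<open>X\<close>. Vanishing torsion changes \<open>\<Gamma> Y X\<close> into
  \<open>\<Gamma> X Y\<close> by a commutator, which is orthogonal to \<open>X\<close> by
  bi-invariance. So the connection drops out of divergences, whichever one the choice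
  returns.\<close>

lemma levi_civita_inner_self:
  assumes "X \<in> lie_algebra G" "Y \<in> lie_algebra G"
  shows "levi_civita G X Y \<bullet> X = 0"
proof -
  let ?\<Gamma> = "levi_civita G"
  have t: "?\<Gamma> X Y - ?\<Gamma> Y X = X ** Y - Y ** X"
    and "?\<Gamma> Y X \<bullet> X + X \<bullet> ?\<Gamma> Y X = 0"
    using levi_civita assms unfolding is_levi_civita_def scalar_prod_eq_inner by blast+
  then have "?\<Gamma> Y X \<bullet> X = 0"
    by (simp add: inner_commute)
  moreover have "(X ** Y) \<bullet> X = - (Y \<bullet> (X ** X))" "(Y ** X) \<bullet> X = - (Y \<bullet> (X ** X))"
    using inner_mult_swap[of X Y X] inner_mult_swap[of Y X X] assms adj_lie_algebra
    by (simp_all add: matrix_mult.minus_left matrix_mult.minus_right)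
  ultimately show ?thesis
    using arg_cong[OF t, of "\<lambda>A. A \<bullet> X"] by (simp add: inner_diff_left)
qed

text \<open>The left translates of the \<open>e i\<close> are a witness for the choice.\<close>

lemma orthonormal_basis_at_some:
  assumes "z \<in> G"
  shows "orthonormal_basis_at G z (SOME B. orthonormal_basis_at G z B)"
proof (rule someI)
  have "span ((**) z ` e ` I) = (**) z ` span (e ` I)"
    by (rule linear_span_image) (simp add: linear_conv_bounded_linear matrix_mult.bounded_linear_right)
  moreover have cancel: "z ** X = z ** Y \<longleftrightarrow> X = Y" for X Y :: "complex^'n^'n"
    by (metis matrix_inv_cancel unitary assms)
  ultimately show "orthonormal_basis_at G z ((**) z ` e ` I)"
    unfolding orthonormal_basis_at_def tangent_space_eq[OF assms]
    using finite_I orthonormal unitary[OF assms] span_basis inj_basis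
    by (auto simp: metric_translate cancel inj_on_eq_iff)
qed

text \<open>The connection term vanishes by \<open>levi_civita_inner_self\<close>, which leaves the
  trace of \<open>\<xi>'\<close>; this trace does not depend on the orthonormal basis.\<close>

lemma divergence_eq:
  assumes z: "z \<in> G"
    and \<xi>: "matrix_inv z ** V z \<in> lie_algebra G"
    and d: "((\<lambda>w. matrix_inv w ** V w) has_derivative \<xi>') (at z within G)"
  shows "divergence G V z = (\<Sum>i\<in>I. \<xi>' (z ** e i) \<bullet> e i)"
proof -
  define B where "B = (SOME B. orthonormal_basis_at G z B)"
  have "orthonormal_basis_at G z B"
    unfolding B_def by (rule orthonormal_basis_at_some[OF z])
  then have B: "finite B" "span B = tangent_space G z"
    "\<And>b b'. b \<in> B \<Longrightarrow> b' \<in> B \<Longrightarrow> metric z b b' = (if b = b' then 1 else 0)"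
    by (simp_all add: orthonormal_basis_at_def)
  \<comment> \<open>The chosen basis \<open>B\<close> is unknown; \<open>E\<close> is its translate
    to the identity, an orthonormal basis of the Lie algebra.\<close>
  define E where "E = (**) (adj z) ` B"
  have zz: "z ** adj z = mat 1" "adj z ** z = mat 1"
    using unitary[OF z] unitary_iff unitary_adj_mult by auto
  have inj: "inj_on ((**) (adj z)) B"
    by (rule inj_on_inverseI[of _ "(**) z"]) (simp add: matrix_mul_assoc zz)
  have Bz: "b = z ** (adj z ** b)" for b :: "complex^'n^'n"
    by (simp add: matrix_mul_assoc zz)
  have "span E = (**) (adj z) ` span B"
    unfolding E_def
    by (rule linear_span_image) (simp add: linear_conv_bounded_linear matrix_mult.bounded_linear_right)
  then have spanE: "span E = lie_algebra G"
    unfolding B tangent_space_eq[OF z] by (simp add: image_image matrix_mul_assoc zz)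
  have finE: "finite E"
    by (simp add: E_def B)
  have orthE: "a \<bullet> b = (if a = b then 1 else 0)" if "a \<in> E" "b \<in> E" for a b
  proof -
    obtain a' b' where ab: "a' \<in> B" "b' \<in> B" "a = adj z ** a'" "b = adj z ** b'"
      using \<open>a \<in> E\<close> \<open>b \<in> E\<close> by (auto simp: E_def)
    have "a \<bullet> b = metric z a' b'"
      using metric_translate[OF unitary[OF z], of a b] ab by (simp flip: Bz)
    then show ?thesis
      using B(3) ab inj by (auto simp: inj_on_def)
  qed
  have E_expand: "(\<Sum>b\<in>E. (X \<bullet> b) *\<^sub>R b) = X" if "X \<in> lie_algebra G" for X
  proof (rule orthonormal_basis_expand)
    show "pairwise orthogonal E"
      using orthE by (auto simp: pairwise_def orthogonal_def)
  qed (use that spanE finE orthE in \<open>auto simp: norm_eq_1\<close>)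
  have E_in: "b \<in> lie_algebra G" if "b \<in> E" for b
    using that spanE span_base by blast
  have lin: "linear \<xi>'"
    using d has_derivative_linear by blast
  have \<xi>'_in: "\<xi>' (z ** b) \<bullet> X = (\<Sum>i\<in>I. (\<xi>' (z ** b) \<bullet> e i) * (X \<bullet> e i))" 
    if "X \<in> lie_algebra G" for X b
    using arg_cong[OF basis_expand[OF that], of "\<lambda>A. \<xi>' (z ** b) \<bullet> A"]
    by (simp add: inner_sum_right mult.commute)
  have "divergence G V z = (\<Sum>b\<in>B. metric z (cov_deriv G V z b) b)"
    by (simp add: divergence_def B_def)
  also have "\<dots> = (\<Sum>b\<in>E. metric z (cov_deriv G V z (z ** b)) (z ** b))"
    unfolding E_def by (simp add: sum.reindex[OF inj] flip: Bz)
  also have "\<dots> = (\<Sum>b\<in>E. \<xi>' (z ** b) \<bullet> b)"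
  proof (rule sum.cong)
    fix b assume b: "b \<in> E"
    have "z ** b \<in> tangent_space G z"
      using E_in[OF b] tangent_space_eq[OF z] by blast
    from frechet_derivative_tangent[OF d this]
    have "cov_deriv G V z (z ** b) = z ** (\<xi>' (z ** b) + levi_civita G b (matrix_inv z ** V z))"
      by (simp add: cov_deriv_def matrix_inv_cancel unitary[OF z])
    then show "metric z (cov_deriv G V z (z ** b)) (z ** b) = \<xi>' (z ** b) \<bullet> b"
      using levi_civita_inner_self[OF E_in[OF b] \<xi>]
      by (simp add: metric_translate unitary[OF z] inner_add_left)
  qed simp
  \<comment> \<open>Expand each \<open>b\<close> in the basis \<open>e\<close>, swap the sums, and
    recover \<open>e i\<close> from its expansion in \<open>E\<close>.\<close>
  also have "\<dots> = (\<Sum>b\<in>E. \<Sum>i\<in>I. (\<xi>' (z ** b) \<bullet> e i) * (b \<bullet> e i))"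
    by (rule sum.cong[OF refl \<xi>'_in[OF E_in]])
  also have "\<dots> = (\<Sum>i\<in>I. \<Sum>b\<in>E. (\<xi>' (z ** b) \<bullet> e i) * (b \<bullet> e i))"
    by (rule sum.swap)
  also have "\<dots> = (\<Sum>i\<in>I. \<xi>' (z ** (\<Sum>b\<in>E. (e i \<bullet> b) *\<^sub>R b)) \<bullet> e i)"
    by (simp add: matrix_mult.sum_right matrix_mult.scaleR_right linear_sum[OF lin]
        linear_scale[OF lin] inner_sum_left inner_commute[of "e i" for i] mult.commute)
  also have "\<dots> = (\<Sum>i\<in>I. \<xi>' (z ** e i) \<bullet> e i)"
    by (rule sum.cong) (simp_all add: E_expand basis_in)
  finally show ?thesis .
qed

text \<open>The sum represents the differential by orthonormality; two representatives agree because
  pairing their difference with itself gives zero.\<close>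

lemma grad_eq:
  fixes f :: "complex^'n^'n \<Rightarrow> real"
  assumes z: "z \<in> G" and f: "(f has_derivative f') (at z within G)"
  shows "grad G f z = z ** (\<Sum>i\<in>I. f' (z ** e i) *\<^sub>R e i)"
  unfolding grad_def
proof (rule the_equality)
  have lin: "linear f'"
    using f has_derivative_linear by blast
  let ?X = "\<Sum>i\<in>I. f' (z ** e i) *\<^sub>R e i"
  have X_in: "?X \<in> lie_algebra G"
    by (intro subspace_sum subspace_scale subspace_lie_algebra basis_in)
  have X: "metric z (z ** ?X) w = frechet_derivative f (at z within G) w"
    if w: "w \<in> tangent_space G z" for w
  proof -
    obtain Y where Y: "Y \<in> lie_algebra G" "w = z ** Y"
      using w tangent_space_eq[OF z] by blast
    have "f' w = f' (z ** (\<Sum>i\<in>I. (Y \<bullet> e i) *\<^sub>R e i))"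
      by (simp only: basis_expand Y)
    also have "\<dots> = ?X \<bullet> Y"
      by (simp add: matrix_mult.sum_right matrix_mult.scaleR_right linear_sum[OF lin]
        linear_scale[OF lin] inner_sum_left inner_commute[of Y] mult.commute)
    finally show ?thesis
      using frechet_derivative_tangent[OF f w] Y by (simp add: metric_translate unitary[OF z])
  qed
  then show "z ** ?X \<in> tangent_space G z \<and>
    (\<forall>w\<in>tangent_space G z. metric z (z ** ?X) w = frechet_derivative f (at z within G) w)"
    using X_in tangent_space_eq[OF z] by blast
  fix v assume v: "v \<in> tangent_space G z \<and>
    (\<forall>w\<in>tangent_space G z. metric z v w = frechet_derivative f (at z within G) w)"
  then obtain Y where Y: "Y \<in> lie_algebra G" "v = z ** Y"
    using tangent_space_eq[OF z] by blast
  have "metric z v (z ** (Y - ?X)) = metric z (z ** ?X) (z ** (Y - ?X))"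
  proof -
    have "z ** (Y - ?X) \<in> tangent_space G z"
      using Y X_in tangent_space_eq[OF z] subspace_diff[OF subspace_lie_algebra] by blast
    then show ?thesis
      using v X by simp
  qed
  then have "(Y - ?X) \<bullet> (Y - ?X) = 0"
    by (simp add: Y metric_translate unitary[OF z] inner_diff_left)
  then show "v = z ** ?X"
    using Y by simp
qed

text \<open>\<open>g\<close> has to match the differentiable \<open>f\<close> only on
  \<open>G \<inter> S\<close>. This permits iteration, as the formula for a Laplacian is available
  only there.\<close>

lemma laplace_beltrami_real_eq:
  fixes f g :: "complex^'n^'n \<Rightarrow> real"
  assumes z: "z \<in> G" "z \<in> S" and S: "open S"
    and fg: "\<And>w. w \<in> G \<inter> S \<Longrightarrow> g w = f w"
    and f: "\<And>w. w \<in> S \<Longrightarrow> (f has_derivative f' w) (at w)"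
    and h: "\<And>i. i \<in> I \<Longrightarrow> ((\<lambda>w. f' w (w ** e i)) has_derivative h i) (at z)"
  shows "laplace_beltrami_real G g z = (\<Sum>i\<in>I. h i (z ** e i))"
proof -
  have gS: "grad G g w = w ** (\<Sum>i\<in>I. f' w (w ** e i) *\<^sub>R e i)" if w: "w \<in> G \<inter> S" for w
  proof (rule grad_eq)
    show "w \<in> G" using w by simp
    have "(f has_derivative f' w) (at w within G)"
      using f w by (auto intro: has_derivative_at_withinI)
    then show "(g has_derivative f' w) (at w within G)"
    proof (rule has_derivative_transform_eventually)
      have "\<forall>\<^sub>F x in at w within G. x \<in> G \<inter> S"
        using S w by (auto simp: eventually_at_topological intro!: exI[of _ S])
      then show "\<forall>\<^sub>F x in at w within G. f x = g x"
        by (rule eventually_mono) (simp add: fg)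
    qed (use w fg in auto)
  qed
  have "laplace_beltrami_real G g z = (\<Sum>i\<in>I. (\<Sum>k\<in>I. h k (z ** e i) *\<^sub>R e k) \<bullet> e i)"
    unfolding laplace_beltrami_real_def
  proof (rule divergence_eq[OF z(1)])
    show "matrix_inv z ** grad G g z \<in> lie_algebra G"
      using z gS[of z] unitary[OF z(1)]
      by (auto simp: matrix_inv_cancel
          intro!: subspace_sum subspace_scale subspace_lie_algebra basis_in)
    have "((\<lambda>w. \<Sum>k\<in>I. f' w (w ** e k) *\<^sub>R e k) has_derivative (\<lambda>v. \<Sum>k\<in>I. h k v *\<^sub>R e k)) (at z within G)"
      by (intro has_derivative_sum has_derivative_scaleR_left has_derivative_at_withinI[OF h])
    then show "((\<lambda>w. matrix_inv w ** grad G g w) has_derivative (\<lambda>v. \<Sum>k\<in>I. h k v *\<^sub>R e k)) (at z within G)"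
    proof (rule has_derivative_transform_eventually)
      have "\<forall>\<^sub>F x in at z within G. x \<in> G \<inter> S"
        using S z by (auto simp: eventually_at_topological intro!: exI[of _ S])
      then show "\<forall>\<^sub>F w in at z within G. (\<Sum>k\<in>I. f' w (w ** e k) *\<^sub>R e k) = matrix_inv w ** grad G g w"
        by (rule eventually_mono) (simp add: gS matrix_inv_cancel unitary)
    qed (use z gS in \<open>auto simp: matrix_inv_cancel unitary\<close>)
  qed
  also have "\<dots> = (\<Sum>i\<in>I. \<Sum>k\<in>I. if k = i then h i (z ** e i) else 0)"
    by (intro sum.cong) (auto simp: inner_sum_left orthonormal intro!: sum.cong)
  also have "\<dots> = (\<Sum>i\<in>I. h i (z ** e i))"
    by (simp add: finite_I)
  finally show ?thesis .
qed

end

section \<open>Calculus of derivatives along left-invariant fields\<close>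

text \<open>The derivative of \<open>F\<close> on \<open>S\<close> along the left-invariant field \<open>w \<mapsto> w X\<close> is \<open>F1\<close>.\<close>

definition lie_deriv ::
  "complex^'n^'n \<Rightarrow> (complex^'n^'n) set \<Rightarrow> (complex^'n^'n \<Rightarrow> complex) \<Rightarrow> (complex^'n^'n \<Rightarrow> complex) \<Rightarrow> bool"
  where "lie_deriv X S F F1 \<longleftrightarrow> (\<forall>w\<in>S. \<exists>F'. (F has_derivative F') (at w) \<and> F' (w ** X) = F1 w)"

lemma lie_deriv_cong:
  "lie_deriv X S F F1 \<Longrightarrow> (\<And>w. w \<in> S \<Longrightarrow> F1 w = F2 w) \<Longrightarrow> lie_deriv X S F F2"
  by (auto simp: lie_deriv_def)

lemma lie_deriv_const: "lie_deriv X S (\<lambda>w. c) (\<lambda>w. 0)"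
  unfolding lie_deriv_def by (auto intro!: exI[of _ "\<lambda>v. 0"])

lemma lie_deriv_entry: 
  "lie_deriv (X :: complex^'n^'n) S (\<lambda>w. w $ i $ j) (\<lambda>w. (w ** X) $ i $ j)"
proof -
  have "bounded_linear (\<lambda>w :: complex^'n^'n. w $ i $ j)"
    by (rule bounded_linear_compose[OF bounded_linear_vec_nth bounded_linear_vec_nth])
  then show ?thesis
    unfolding lie_deriv_def using bounded_linear_imp_has_derivative by blast
qed

lemma lie_deriv_add:
  assumes "lie_deriv X S F F1" "lie_deriv X S G G1"
  shows "lie_deriv X S (\<lambda>w. F w + G w) (\<lambda>w. F1 w + G1 w)"
  unfolding lie_deriv_def
proof
  fix w assume "w \<in> S"
  then obtain F' G' where "(F has_derivative F') (at w)" "F' (w ** X) = F1 w"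
    "(G has_derivative G') (at w)" "G' (w ** X) = G1 w"
    using assms unfolding lie_deriv_def by metis
  then show "\<exists>D. ((\<lambda>w. F w + G w) has_derivative D) (at w) \<and> D (w ** X) = F1 w + G1 w"
    by (intro exI[of _ "\<lambda>v. F' v + G' v"]) (auto intro: has_derivative_add)
qed

lemma lie_deriv_mult:
  assumes "lie_deriv X S F F1" "lie_deriv X S G G1"
  shows "lie_deriv X S (\<lambda>w. F w * G w) (\<lambda>w. F w * G1 w + F1 w * G w)"
  unfolding lie_deriv_def
proof
  fix w assume "w \<in> S"
  then obtain F' G' where "(F has_derivative F') (at w)" "F' (w ** X) = F1 w"
    "(G has_derivative G') (at w)" "G' (w ** X) = G1 w"
    using assms unfolding lie_deriv_def by metis
  then show "\<exists>D. ((\<lambda>w. F w * G w) has_derivative D) (at w) \<and> D (w ** X) = F w * G1 w + F1 w * G w"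
    by (intro exI[of _ "\<lambda>v. F w * G' v + F' v * G w"]) (auto intro: has_derivative_mult)
qed

lemma lie_deriv_divide:
  assumes "lie_deriv X S F F1" "lie_deriv X S G G1" "\<And>w. w \<in> S \<Longrightarrow> G w \<noteq> 0"
  shows "lie_deriv X S (\<lambda>w. F w / G w) (\<lambda>w. (F1 w * G w - F w * G1 w) / (G w * G w))"
  unfolding lie_deriv_def
proof
  fix w assume w: "w \<in> S"
  then obtain F' G' where "(F has_derivative F') (at w)" "F' (w ** X) = F1 w"
    "(G has_derivative G') (at w)" "G' (w ** X) = G1 w"
    using assms unfolding lie_deriv_def by metis
  then show "\<exists>D. ((\<lambda>w. F w / G w) has_derivative D) (at w) \<and>
      D (w ** X) = (F1 w * G w - F w * G1 w) / (G w * G w)"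
    using assms(3)[OF w]
    by (intro exI[of _ "\<lambda>v. (F' v * G w - F w * G' v) / (G w * G w)"])
      (auto intro: has_derivative_divide')
qed

lemma lie_deriv_scaleR:
  assumes "lie_deriv X S F F1"
  shows "lie_deriv (r *\<^sub>R X) S F (\<lambda>w. of_real r * F1 w)"
  unfolding lie_deriv_def
proof
  fix w assume w: "w \<in> S"
  then obtain F' where F': "(F has_derivative F') (at w)" "F' (w ** X) = F1 w"
    using assms unfolding lie_deriv_def by metis
  have "F' (w ** (r *\<^sub>R X)) = of_real r * F1 w"
    using linear_scale[OF has_derivative_linear[OF F'(1)], of r "w ** X"]
    by (simp only: matrix_mult.scaleR_right F'(2)) (simp add: scaleR_conv_of_real)
  then show "\<exists>D. (F has_derivative D) (at w) \<and> D (w ** (r *\<^sub>R X)) = of_real r * F1 w"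
    using F' by blast
qed

lemmas lie_deriv_intros = lie_deriv_const lie_deriv_entry lie_deriv_add lie_deriv_mult

context unitary_matrix_group_basis
begin

lemma laplace_beltrami_eq:
  assumes z: "z \<in> G" "z \<in> S" and S: "open S" and "I \<noteq> {}"
    and fg: "\<And>w. w \<in> G \<inter> S \<Longrightarrow> g w = F w"
    and L1: "\<And>i. i \<in> I \<Longrightarrow> lie_deriv (e i) S F (F1 i)"
    and L2: "\<And>i. i \<in> I \<Longrightarrow> lie_deriv (e i) S (F1 i) (F2 i)"
  shows "laplace_beltrami G g z = (\<Sum>i\<in>I. F2 i z)"
proof -
  \<comment> \<open>\<open>lie_deriv\<close> hides the full derivative behind an existential;
    \<open>D\<close> names it, and any index of the nonempty \<open>I\<close> supplies its existence
    on \<open>S\<close>.\<close>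
  define D where "D w = frechet_derivative F (at w)" for w
  have D: "(F has_derivative D w) (at w)" if "w \<in> S" for w
  proof -
    obtain i where "i \<in> I"
      using \<open>I \<noteq> {}\<close> by blast
    then show ?thesis
      using L1 that frechet_derivative_at unfolding lie_deriv_def D_def by metis
  qed
  have D_eq: "D w (w ** e i) = F1 i w" if "w \<in> S" "i \<in> I" for w i
    using L1[OF that(2)] D[OF that(1)] that(1) has_derivative_unique unfolding lie_deriv_def by metis
  have "\<forall>i\<in>I. \<exists>F'. (F1 i has_derivative F') (at z) \<and> F' (z ** e i) = F2 i z"
    using L2 z(2) unfolding lie_deriv_def by blast
  then obtain F1' where F1': "\<And>i. i \<in> I \<Longrightarrow> (F1 i has_derivative F1' i) (at z)"
    "\<And>i. i \<in> I \<Longrightarrow> F1' i (z ** e i) = F2 i z"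
    by metis
  \<comment> \<open>\<open>L\<close> stands for \<open>Re\<close> and \<open>Im\<close>, which are
    treated at once.\<close>
  have *: "laplace_beltrami_real G (\<lambda>w. L (g w)) z = L (\<Sum>i\<in>I. F2 i z)"
    if L: "bounded_linear L" for L :: "complex \<Rightarrow> real"
  proof -
    have "laplace_beltrami_real G (\<lambda>w. L (g w)) z = (\<Sum>i\<in>I. L (F1' i (z ** e i)))"
    proof (rule laplace_beltrami_real_eq[OF z S])
      show "L (g w) = L (F w)" if "w \<in> G \<inter> S" for w
        using fg[OF that] by simp
      show "((\<lambda>w. L (F w)) has_derivative (\<lambda>v. L (D w v))) (at w)" if "w \<in> S" for w
        using bounded_linear.has_derivative[OF L D[OF that]] .
      fix i assume i: "i \<in> I"
      show "((\<lambda>w. L (D w (w ** e i))) has_derivative (\<lambda>v. L (F1' i v))) (at z)"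
        by (rule has_derivative_transform_within_open[OF bounded_linear.has_derivative[OF L F1'(1)[OF i]] S z(2)])
          (simp add: D_eq i)
    qed
    also have "\<dots> = L (\<Sum>i\<in>I. F2 i z)"
      by (simp add: F1'(2) linear_sum[OF bounded_linear.linear[OF L]])
    finally show ?thesis .
  qed
  show ?thesis
    unfolding laplace_beltrami_def *[OF bounded_linear_Re] *[OF bounded_linear_Im]
    by (simp add: complex_eq_iff)
qed

end

section \<open>Orthonormal bases for U(2) and SU(2)\<close>

text \<open>These are \<open>\<i>\<close> times the Pauli matrices and, at index 3,
  \<open>\<i>\<close> times the identity. The first three are a real basis of the trace-free
  skew-Hermitian matrices, so the index bounds 3 and 4 serve SU(2) and U(2). Each has squared norm
  2.\<close>

definition pauli :: "nat \<Rightarrow> complex^2^2" where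
  "pauli k =
     (if k = 0 then vector [vector [\<i>, 0], vector [0, - \<i>]]
      else if k = 1 then vector [vector [0, 1], vector [- 1, 0]]
      else if k = 2 then vector [vector [0, \<i>], vector [\<i>, 0]]
      else vector [vector [\<i>, 0], vector [0, \<i>]])"

definition u2_basis :: "nat \<Rightarrow> complex^2^2" where
  "u2_basis k = (1 / sqrt 2) *\<^sub>R pauli k"

lemma mat2_eq_iff:
  fixes X Y :: "'a^2^2"
  shows "X = Y \<longleftrightarrow> X $ 1 $ 1 = Y $ 1 $ 1 \<and> X $ 1 $ 2 = Y $ 1 $ 2 \<and> X $ 2 $ 1 = Y $ 2 $ 1 \<and> X $ 2 $ 2 = Y $ 2 $ 2"
  by (auto simp: vec_eq_iff forall_2)

lemma lessThan_nat_cases: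
  "k < 4 \<Longrightarrow> k = 0 \<or> k = 1 \<or> k = 2 \<or> k = (3::nat)"
  by auto

lemma adj_pauli: "adj (pauli k) = - pauli k"
  by (auto simp: mat2_eq_iff adj_def pauli_def)

lemma pauli_square: "pauli k ** pauli k = - mat 1"
  by (auto simp: mat2_eq_iff matrix_matrix_mult_def sum_2 pauli_def mat_def)

lemma inner_pauli:
  assumes "i < 4" "k < 4"
  shows "pauli i \<bullet> pauli k = (if i = k then 2 else 0)"
  using assms[THEN lessThan_nat_cases]
  by (elim disjE) (simp_all add: pauli_def inner_vec_def sum_2 inner_complex_def)

lemma inner_u2_basis:
  assumes "i < 4" "k < 4"
  shows "u2_basis i \<bullet> u2_basis k = (if i = k then 1 else 0)"
  using inner_pauli[OF assms] by (simp add: u2_basis_def)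

text \<open>If \<open>Y ** Y = - mat 1\<close>, this is the exponential of
  \<open>t *\<^sub>R Y\<close>.\<close>

definition rot :: "complex^'n^'n \<Rightarrow> real \<Rightarrow> complex^'n^'n" where
  "rot Y t = cos t *\<^sub>R mat 1 + sin t *\<^sub>R Y"

lemma rot_unitary:
  assumes "adj Y = - Y" "Y ** Y = - mat 1"
  shows "rot Y t \<in> unitary_group"
proof -
  have "adj (rot Y t) = cos t *\<^sub>R mat 1 - sin t *\<^sub>R Y"
    using assms by (simp add: rot_def linear_add[OF linear_adj] linear_scale[OF linear_adj])
  then have "rot Y t ** adj (rot Y t) =
      (cos t *\<^sub>R mat 1 + sin t *\<^sub>R Y) ** (cos t *\<^sub>R mat 1 - sin t *\<^sub>R Y)"
    by (simp add: rot_def)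
  also have "\<dots> = (cos t * cos t) *\<^sub>R mat 1 + (sin t * sin t) *\<^sub>R mat 1"
    by (simp add: matrix_mult.add_left matrix_mult.diff_right matrix_mult.scaleR_left
        matrix_mult.scaleR_right assms algebra_simps)
  also have "\<dots> = ((cos t)\<^sup>2 + (sin t)\<^sup>2) *\<^sub>R mat 1"
    by (simp only: scaleR_add_left power2_eq_square)
  finally show ?thesis
    by (simp add: unitary_iff)
qed

lemma rot_velocity: "(rot Y has_vector_derivative Y) (at 0)"
  unfolding rot_def by (auto intro!: derivative_eq_intros)

lemma rot_lie_algebra:
  assumes "\<And>t. rot Y t \<in> G"
  shows "Y \<in> lie_algebra G"
  unfolding lie_algebra_def tangent_space_def using assms rot_velocity[of Y]
  by (auto intro!: exI[of _ "rot Y"] simp: rot_def)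

lemma det_rot_pauli:
  assumes "k < 3"
  shows "det (rot (pauli k) t) = 1"
proof -
  have "det (rot (pauli k) t) = (of_real (cos t))\<^sup>2 + (of_real (sin t))\<^sup>2"
    using lessThan_nat_cases[of k] assms
    by (auto simp: det_2 rot_def pauli_def mat_def scaleR_conv_of_real[where 'a = complex] power2_eq_square algebra_simps)
  also have "\<dots> = of_real ((cos t)\<^sup>2 + (sin t)\<^sup>2)"
    by (simp only: of_real_add of_real_power)
  finally show ?thesis
    by simp
qed

lemma rot_pauli_special: "k < 3 \<Longrightarrow> rot (pauli k) t \<in> special_unitary_group"
  by (simp add: special_unitary_group_def det_rot_pauli rot_unitary adj_pauli pauli_square)

interpretation U: unitary_matrix_group "unitary_group :: (complex^'n^'n) set"
  by unfold_locales (auto simp: mat_1_unitary unitary_mult unitary_adj)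

lemma det_adj: "det (adj z) = cnj (det (z :: complex^2^2))"
  by (simp add: det_2 adj_def)

interpretation SU: unitary_matrix_group "special_unitary_group :: (complex^2^2) set"
proof
  show "special_unitary_group \<subseteq> (unitary_group :: (complex^2^2) set)"
    by (auto simp: special_unitary_group_def)
  show "(mat 1 :: complex^2^2) \<in> special_unitary_group"
    by (simp add: special_unitary_group_def mat_1_unitary)
  show "z ** w \<in> special_unitary_group"
    if "z \<in> special_unitary_group" "w \<in> special_unitary_group" for z w :: "complex^2^2"
    using that by (simp add: special_unitary_group_def unitary_mult det_mul)
  show "adj z \<in> special_unitary_group" if "z \<in> special_unitary_group" for z :: "complex^2^2"
    using that by (simp add: special_unitary_group_def unitary_adj det_adj)
qed

text \<open>The diagonal is imaginary and the upper right entry determines the lower left one, which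
  leaves four real coordinates.\<close>

lemma pauli_expand:
  assumes "adj X = - X"
  shows "X = ((Im (X $ 1 $ 1) - Im (X $ 2 $ 2)) / 2) *\<^sub>R pauli 0 + Re (X $ 1 $ 2) *\<^sub>R pauli 1
    + Im (X $ 1 $ 2) *\<^sub>R pauli 2 + ((Im (X $ 1 $ 1) + Im (X $ 2 $ 2)) / 2) *\<^sub>R pauli 3"
proof -
  have *: "cnj (X $ j $ i) = - X $ i $ j" for i j
    using arg_cong[OF assms, of "\<lambda>Y. Y $ i $ j"] by (simp add: adj_def)
  have "Re (X $ i $ i) = 0" for i
    using arg_cong[OF *[of i i], of Re] by simp
  moreover have "X $ 2 $ 1 = - cnj (X $ 1 $ 2)"
    using *[of 1 2] by simp
  ultimately show ?thesis
    by (simp add: mat2_eq_iff pauli_def complex_eq_iff field_simps)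
qed

lemma pauli_in_span:
  assumes "k \<in> I"
  shows "c *\<^sub>R pauli k \<in> span (u2_basis ` I)"
proof -
  have "c *\<^sub>R pauli k = (c * sqrt 2) *\<^sub>R u2_basis k"
    by (simp add: u2_basis_def)
  then show ?thesis
    using assms by (simp only: span_scale span_base imageI)
qed

text \<open>The derivative of \<open>det\<close> at the identity is the trace, and
  \<open>det\<close> is constant along curves in the group.\<close>

lemma trace_lie_algebra_special:
  fixes X :: "complex^2^2"
  assumes "X \<in> lie_algebra special_unitary_group"
  shows "trace X = 0"
proof -
  obtain \<gamma> where \<gamma>: "\<forall>t. \<gamma> t \<in> special_unitary_group" "\<gamma> 0 = mat 1" "(\<gamma> has_vector_derivative X) (at 0)"
    using assms by (auto simp: lie_algebra_def tangent_space_def)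
  have c: "((\<lambda>t. \<gamma> t $ i $ j) has_vector_derivative X $ i $ j) (at 0)" for i j
    by (intro bounded_linear.has_vector_derivative[OF bounded_linear_vec_nth] \<gamma>)
  have "((\<lambda>t. det (\<gamma> t)) has_vector_derivative X $ 1 $ 1 + X $ 2 $ 2) (at 0)"
    unfolding det_2
    by (rule has_vector_derivative_eq_rhs[OF has_vector_derivative_diff[OF
            has_vector_derivative_mult[OF c c] has_vector_derivative_mult[OF c c]]])
      (simp add: \<gamma>(2) mat_def)
  moreover have "(\<lambda>t. det (\<gamma> t)) = (\<lambda>t. 1)"
    using \<gamma>(1) by (auto simp: special_unitary_group_def)
  ultimately have "((\<lambda>t::real. 1::complex) has_vector_derivative X $ 1 $ 1 + X $ 2 $ 2) (at 0)"
    by simp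
  then have "X $ 1 $ 1 + X $ 2 $ 2 = 0"
    using vector_derivative_unique_at has_vector_derivative_const by blast
  then show ?thesis
    by (simp add: trace_def sum_2)
qed

text \<open>Three inclusions in a circle: the basis consists of multiples of velocities of
  \<open>rot\<close>, velocities are skew-Hermitian, and skew-Hermitian matrices expand in the
  basis.\<close>

lemma lie_algebra_unitary_2:
  "lie_algebra (unitary_group :: (complex^2^2) set) = {X. adj X = - X}"
  "span (u2_basis ` {..<4}) = {X. adj X = - X}"
proof -
  let ?A = "span (u2_basis ` {..<4})" and ?B = "lie_algebra (unitary_group :: (complex^2^2) set)"
  have "?A \<subseteq> ?B"
  proof (rule span_minimal)
    have "pauli k \<in> ?B" for k
      by (intro rot_lie_algebra rot_unitary adj_pauli pauli_square)
    then show "u2_basis ` {..<4} \<subseteq> ?B"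
      by (auto simp: u2_basis_def intro!: subspace_scale[OF U.subspace_lie_algebra])
  qed (rule U.subspace_lie_algebra)
  moreover have "?B \<subseteq> {X. adj X = - X}"
    using U.adj_lie_algebra by blast
  moreover have "{X. adj X = - X} \<subseteq> ?A"
  proof
    fix X :: "complex^2^2" assume "X \<in> {X. adj X = - X}"
    then have "adj X = - X" by simp
    from pauli_expand[OF this] show "X \<in> ?A"
      by (rule ssubst) (intro span_add pauli_in_span; simp)
  qed
  ultimately show "?B = {X. adj X = - X}" "?A = {X. adj X = - X}"
    by blast+
qed

lemma lie_algebra_special_unitary_2:
  "lie_algebra (special_unitary_group :: (complex^2^2) set) = {X. adj X = - X \<and> trace X = 0}"
  "span (u2_basis ` {..<3}) = {X. adj X = - X \<and> trace X = 0}"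
proof -
  let ?A = "span (u2_basis ` {..<3})" and ?B = "lie_algebra (special_unitary_group :: (complex^2^2) set)"
  have "?A \<subseteq> ?B"
  proof (rule span_minimal)
    have "pauli k \<in> ?B" if "k < 3" for k
      by (intro rot_lie_algebra rot_pauli_special that)
    then show "u2_basis ` {..<3} \<subseteq> ?B"
      by (auto simp: u2_basis_def intro!: subspace_scale[OF SU.subspace_lie_algebra])
  qed (rule SU.subspace_lie_algebra)
  moreover have "?B \<subseteq> {X. adj X = - X \<and> trace X = 0}"
    using SU.adj_lie_algebra trace_lie_algebra_special by blast
  moreover have "{X. adj X = - X \<and> trace X = 0} \<subseteq> ?A"
  proof
    fix X :: "complex^2^2" assume X: "X \<in> {X. adj X = - X \<and> trace X = 0}"
    \<comment> \<open>Trace zero kills the coefficient of \<open>pauli 3\<close> in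
      \<open>pauli_expand\<close>.\<close>
    then have "Im (X $ 1 $ 1) + Im (X $ 2 $ 2) = 0"
      by (auto simp: trace_def sum_2 complex_eq_iff)
    with X pauli_expand[of X] have "X = ((Im (X $ 1 $ 1) - Im (X $ 2 $ 2)) / 2) *\<^sub>R pauli 0
        + Re (X $ 1 $ 2) *\<^sub>R pauli 1 + Im (X $ 1 $ 2) *\<^sub>R pauli 2"
      by simp
    then show "X \<in> ?A"
      by (rule ssubst) (intro span_add pauli_in_span; simp)
  qed
  ultimately show "?B = {X. adj X = - X \<and> trace X = 0}" "?A = {X. adj X = - X \<and> trace X = 0}"
    by blast+
qed

interpretation U2: unitary_matrix_group_basis "unitary_group :: (complex^2^2) set" "{..<4}" u2_basis
proof unfold_locales
  show "X ** Y - Y ** X \<in> lie_algebra unitary_group"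
    if "X \<in> lie_algebra unitary_group" "Y \<in> lie_algebra unitary_group" for X Y :: "complex^2^2"
    using that unfolding lie_algebra_unitary_2
    by (simp add: linear_diff[OF linear_adj] adj_mult matrix_mult.minus_left matrix_mult.minus_right)
  show "span (u2_basis ` {..<4}) = lie_algebra unitary_group"
    by (simp only: lie_algebra_unitary_2)
  show "u2_basis i \<bullet> u2_basis k = (if i = k then 1 else 0)" if "i \<in> {..<4}" "k \<in> {..<4}" for i k
    using that by (intro inner_u2_basis) auto
  show "finite {..<4 :: nat}"
    by simp
qed

interpretation SU2: unitary_matrix_group_basis
  "special_unitary_group :: (complex^2^2) set" "{..<3}" u2_basis
proof unfold_locales
  show "X ** Y - Y ** X \<in> lie_algebra special_unitary_group"
    if "X \<in> lie_algebra special_unitary_group" "Y \<in> lie_algebra special_unitary_group"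
    for X Y :: "complex^2^2"
    using that trace_mul_sym[of X Y] unfolding lie_algebra_special_unitary_2
    by (simp add: linear_diff[OF linear_adj] adj_mult matrix_mult.minus_left matrix_mult.minus_right
        trace_sub)
  show "span (u2_basis ` {..<3}) = lie_algebra special_unitary_group"
    by (simp only: lie_algebra_special_unitary_2)
  show "u2_basis i \<bullet> u2_basis k = (if i = k then 1 else 0)" if "i \<in> {..<3}" "k \<in> {..<3}" for i k
    using that by (intro inner_u2_basis) auto
  show "finite {..<3 :: nat}"
    by simp
qed

lemma lie_deriv_diff:
  assumes "lie_deriv X S F F1" "lie_deriv X S G G1"
  shows "lie_deriv X S (\<lambda>w. F w - G w) (\<lambda>w. F1 w - G1 w)"
  using lie_deriv_add[OF assms(1) lie_deriv_mult[OF lie_deriv_const[of X S "- 1"] assms(2)]]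
  by simp

section \<open>The Laplacian of polynomials in the ratios\<close>

text \<open>The six monomials serve both applications of the operator: \<open>f\<close> is a
  combination of the first five, its Laplacian of the last two.\<close>

lemma lie_deriv_second:
  fixes A B C E H K :: complex
  assumes x: "lie_deriv X S x x1" "lie_deriv X S x1 x2"
    and y: "lie_deriv X S y y1" "lie_deriv X S y1 y2"
    and d: "lie_deriv X S d d1" "lie_deriv X S d1 d2"
  shows "lie_deriv X S
      (\<lambda>w. A * x w + B * (x w * x w) + C * y w + E * (x w * y w) + H * d w + K * (x w * d w))
      (\<lambda>w. A * x1 w + B * (2 * (x w * x1 w)) + C * y1 w + E * (x1 w * y w + x w * y1 w)
        + H * d1 w + K * (x1 w * d w + x w * d1 w))" (is ?first)
    and "lie_deriv X S
      (\<lambda>w. A * x1 w + B * (2 * (x w * x1 w)) + C * y1 w + E * (x1 w * y w + x w * y1 w)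
        + H * d1 w + K * (x1 w * d w + x w * d1 w))
      (\<lambda>w. A * x2 w + B * (2 * (x1 w * x1 w + x w * x2 w)) + C * y2 w
        + E * (x2 w * y w + 2 * (x1 w * y1 w) + x w * y2 w)
        + H * d2 w + K * (x2 w * d w + 2 * (x1 w * d1 w) + x w * d2 w))" (is ?second)
proof -
  show ?first
    by (rule lie_deriv_cong, (rule lie_deriv_intros assms)+) (simp add: algebra_simps)
  show ?second
    by (rule lie_deriv_cong, (rule lie_deriv_intros assms)+) (simp add: algebra_simps)
qed

definition lin :: "complex \<Rightarrow> complex \<Rightarrow> 2 \<Rightarrow> complex^2^2 \<Rightarrow> complex" where
  "lin a b j w = a * w $ 1 $ j + b * w $ 2 $ j"

text \<open>Exchanging the columns flips the sign of the action of \<open>pauli 0\<close> and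
  \<open>pauli 1\<close>; this sign lets one computation cover both orders of the columns.\<close>

definition sgn2 :: "2 \<Rightarrow> complex" where
  "sgn2 j = (if j = 1 then 1 else - 1)"

lemma det_unitary_nonzero:
  assumes "z \<in> unitary_group"
  shows "det z \<noteq> 0"
  using arg_cong[OF assms[unfolded unitary_iff], of det] by (auto simp: det_mul)

lemma sgn2_square: "sgn2 j * sgn2 j = 1"
  by (simp add: sgn2_def)

lemma lie_deriv_lin: "lie_deriv X S (lin a b j) (\<lambda>w. lin a b j (w ** X))"
  unfolding lin_def[abs_def]
  by (rule lie_deriv_cong, (rule lie_deriv_intros)+) simp

lemma neq_2_cases: "j \<noteq> l \<Longrightarrow> (j = 1 \<and> l = 2) \<or> (j = 2 \<and> l = (1::2))"
  using exhaust_2[of j] exhaust_2[of l] by auto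

text \<open>Right multiplication mixes columns only, so for every row \<open>(a, b)\<close> the two
  forms transform among themselves with the same coefficients.\<close>

lemma lin_pauli:
  assumes "j \<noteq> l"
  shows "lin a b j (w ** pauli 0) = sgn2 j * \<i> * lin a b j w"
    "lin a b l (w ** pauli 0) = - (sgn2 j * \<i> * lin a b l w)"
    "lin a b j (w ** pauli 1) = - (sgn2 j * lin a b l w)"
    "lin a b l (w ** pauli 1) = sgn2 j * lin a b j w"
    "lin a b j (w ** pauli 2) = \<i> * lin a b l w"
    "lin a b l (w ** pauli 2) = \<i> * lin a b j w"
    "lin a b j (w ** pauli 3) = \<i> * lin a b j w"
    "lin a b l (w ** pauli 3) = \<i> * lin a b l w"
  using neq_2_cases[OF assms]
  by (auto simp: lin_def pauli_def sgn2_def matrix_matrix_mult_def sum_2 algebra_simps)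

definition ratio :: "complex \<Rightarrow> complex \<Rightarrow> complex \<Rightarrow> 2 \<Rightarrow> 2 \<Rightarrow> complex^2^2 \<Rightarrow> complex" where
  "ratio t a b j l w = lin a b l w / lin t 1 j w"

lemma lie_deriv_ratio:
  assumes "\<And>w. w \<in> S \<Longrightarrow> lin t 1 j w \<noteq> 0"
  shows "lie_deriv X S (ratio t a b j l) (\<lambda>w. (lin a b l (w ** X) * lin t 1 j w
    - lin a b l w * lin t 1 j (w ** X)) / (lin t 1 j w * lin t 1 j w))"
  unfolding ratio_def[abs_def] by (intro lie_deriv_divide lie_deriv_lin assms)

text \<open>
  With \<open>u = lin t 1 j\<close>, \<open>v = lin t 1 l\<close> and \<open>a\<close>, \<open>b\<close> the entries of the first row in the columns
  \<open>j\<close>, \<open>l\<close>, these are \<open>x = v / u\<close>, \<open>y = b / u\<close>, \<open>m = a / u\<close> and \<open>d = (a v - b u) / u\<^sup>2\<close>. Every field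
  below maps \<open>x\<close>, \<open>y\<close>, \<open>m\<close> and \<open>d\<close> to polynomials in \<open>x\<close>, \<open>y\<close>, \<open>m\<close> and \<open>d\<close>.
\<close>

context
  fixes t :: complex and j l :: 2 and S :: "(complex^2^2) set"
    and x y m d :: "complex^2^2 \<Rightarrow> complex"
  assumes jl: "j \<noteq> l" and nz: "\<And>w. w \<in> S \<Longrightarrow> lin t 1 j w \<noteq> 0"
  defines "x \<equiv> ratio t t 1 j l" and "y \<equiv> ratio t 1 0 j l" and "m \<equiv> ratio t 1 0 j j"
    and "d \<equiv> \<lambda>w. m w * x w - y w"
begin

lemma lie_deriv_pauli_0:
  "lie_deriv (pauli 0) S x (\<lambda>w. - 2 * sgn2 j * \<i> * x w)"
  "lie_deriv (pauli 0) S y (\<lambda>w. - 2 * sgn2 j * \<i> * y w)"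
  "lie_deriv (pauli 0) S m (\<lambda>w. 0)"
  unfolding x_def y_def m_def
  by (rule lie_deriv_cong[OF lie_deriv_ratio[OF nz]];
      simp add: lin_pauli[OF jl] ratio_def nz field_simps)+

lemma lie_deriv_pauli_1:
  "lie_deriv (pauli 1) S x (\<lambda>w. sgn2 j * (1 + x w * x w))"
  "lie_deriv (pauli 1) S y (\<lambda>w. sgn2 j * (m w + x w * y w))"
  "lie_deriv (pauli 1) S m (\<lambda>w. sgn2 j * d w)"
  unfolding d_def unfolding x_def y_def m_def
  by (rule lie_deriv_cong[OF lie_deriv_ratio[OF nz]];
      simp only: lin_pauli[OF jl] ratio_def; simp add: nz field_simps)+

lemma lie_deriv_pauli_2:
  "lie_deriv (pauli 2) S x (\<lambda>w. \<i> * (1 - x w * x w))"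
  "lie_deriv (pauli 2) S y (\<lambda>w. \<i> * (m w - x w * y w))"
  "lie_deriv (pauli 2) S m (\<lambda>w. - \<i> * d w)"
  unfolding d_def unfolding x_def y_def m_def
  by (rule lie_deriv_cong[OF lie_deriv_ratio[OF nz]];
      simp add: lin_pauli[OF jl] ratio_def nz field_simps)+

text \<open>This field scales all linear forms by one factor, so their ratios are constant along it:
  the infinitesimal form of invariance under the circle action.\<close>

lemma lie_deriv_pauli_3:
  "lie_deriv (pauli 3) S x (\<lambda>w. 0)"
  "lie_deriv (pauli 3) S y (\<lambda>w. 0)"
  "lie_deriv (pauli 3) S m (\<lambda>w. 0)"
  unfolding x_def y_def m_def
  by (rule lie_deriv_cong[OF lie_deriv_ratio[OF nz]];
      simp add: lin_pauli[OF jl] ratio_def nz field_simps)+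

text \<open>Up to sign, \<open>d\<close> is the determinant divided by the square of
  \<open>lin t 1 j\<close>, so its derivatives are multiples of \<open>d\<close> and the terms in
  \<open>m\<close> and \<open>y\<close> cancel.\<close>

lemma lie_deriv_d:
  "lie_deriv (pauli 0) S d (\<lambda>w. - 2 * sgn2 j * \<i> * d w)"
  "lie_deriv (pauli 1) S d (\<lambda>w. 2 * sgn2 j * (x w * d w))"
  "lie_deriv (pauli 2) S d (\<lambda>w. - 2 * \<i> * (x w * d w))"
  "lie_deriv (pauli 3) S d (\<lambda>w. 0)"
proof -
  show "lie_deriv (pauli 0) S d (\<lambda>w. - 2 * sgn2 j * \<i> * d w)"
    unfolding d_def
    by (rule lie_deriv_cong, rule lie_deriv_diff,
        (rule lie_deriv_mult lie_deriv_pauli_0)+) (simp add: algebra_simps)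
  show "lie_deriv (pauli 1) S d (\<lambda>w. 2 * sgn2 j * (x w * d w))"
    unfolding d_def
    by (rule lie_deriv_cong, rule lie_deriv_diff,
        (rule lie_deriv_mult lie_deriv_pauli_1)+) (simp add: d_def algebra_simps)
  show "lie_deriv (pauli 2) S d (\<lambda>w. - 2 * \<i> * (x w * d w))"
    unfolding d_def
    by (rule lie_deriv_cong, rule lie_deriv_diff,
        (rule lie_deriv_mult lie_deriv_pauli_2)+) (simp add: d_def algebra_simps)
  show "lie_deriv (pauli 3) S d (\<lambda>w. 0)"
    unfolding d_def
    by (rule lie_deriv_cong, rule lie_deriv_diff,
        (rule lie_deriv_mult lie_deriv_pauli_3)+) simp
qed

text \<open>The field of \<open>pauli 3\<close> kills \<open>x\<close>, \<open>y\<close> and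
  \<open>d\<close>, so \<open>n = 3\<close> and \<open>n = 4\<close> give the same sum.\<close>

lemma laplace_beltrami_rational:
  assumes G: "unitary_matrix_group_basis G {..<n} u2_basis" and n: "n = 3 \<or> n = 4"
    and S: "open S" and z: "z \<in> G \<inter> S"
    and g: "\<And>w. w \<in> G \<inter> S \<Longrightarrow>
      g w = A * x w + B * (x w * x w) + C * y w + E * (x w * y w) + H * d w + K * (x w * d w)"
  shows "laplace_beltrami G g z = (2 * C + 4 * E * x z) * d z"
proof -
  interpret G: unitary_matrix_group_basis G "{..<n}" u2_basis by (rule G)
  let ?s = "sgn2 j"
  \<comment> \<open>First and second derivatives of \<open>x\<close>, \<open>y\<close>,
    \<open>d\<close> along \<open>pauli k\<close>, tabulated by \<open>k\<close> so that they can be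
    summed.\<close>
  define x1 where "x1 = (\<lambda>(k::nat) w. if k = 0 then - 2 * ?s * \<i> * x w else if k = 1 then ?s * (1 + x w * x w)
    else if k = 2 then \<i> * (1 - x w * x w) else (0 :: complex))"
  define x2 where "x2 = (\<lambda>(k::nat) w. if k = 0 then - 4 * x w else if k = 1 then 2 * x w * (1 + x w * x w)
    else if k = 2 then 2 * x w * (1 - x w * x w) else (0 :: complex))"
  define y1 where "y1 = (\<lambda>(k::nat) w. if k = 0 then - 2 * ?s * \<i> * y w else if k = 1 then ?s * (m w + x w * y w)
    else if k = 2 then \<i> * (m w - x w * y w) else (0 :: complex))"
  define y2 where "y2 = (\<lambda>(k::nat) w. if k = 0 then - 4 * y w
    else if k = 1 then d w + (1 + x w * x w) * y w + x w * (m w + x w * y w)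
    else if k = 2 then d w + (1 - x w * x w) * y w + x w * (m w - x w * y w) else (0 :: complex))"
  define d1 where "d1 = (\<lambda>(k::nat) w. if k = 0 then - 2 * ?s * \<i> * d w else if k = 1 then 2 * ?s * (x w * d w)
    else if k = 2 then - 2 * \<i> * (x w * d w) else (0 :: complex))"
  define d2 where "d2 = (\<lambda>(k::nat) w. if k = 0 then - 4 * d w
    else if k = 1 then 2 * (1 + x w * x w) * d w + 4 * (x w * (x w * d w))
    else if k = 2 then 2 * (1 - x w * x w) * d w - 4 * (x w * (x w * d w)) else (0 :: complex))"
  have s: "?s * ?s = 1" "?s * (?s * c) = c" "\<i> * (\<i> * c) = - c" for c
    using sgn2_square[of j] by (simp_all add: mult.assoc[symmetric])
  note D = lie_deriv_pauli_0 lie_deriv_pauli_1 lie_deriv_pauli_2 lie_deriv_pauli_3 lie_deriv_d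
  note R = lie_deriv_intros lie_deriv_diff D
  \<comment> \<open>Selecting a row of the tables by plain rewriting leaves the terms in the
    syntactic form of the rules in \<open>D\<close>.\<close>
  have ifs: "(if (0::nat) = 0 then a else b) = a"
    "(if (1::nat) = 0 then a else if (1::nat) = 1 then b else c) = b"
    "(if (2::nat) = 0 then a else if (2::nat) = 1 then b else if (2::nat) = 2 then c else e) = c"
    "(if (3::nat) = 0 then a else if (3::nat) = 1 then b else if (3::nat) = 2 then c else e) = e"
    for a b c e :: complex
    by simp_all
  note defs = x1_def x2_def y1_def y2_def d1_def d2_def
  have first: "lie_deriv (pauli k) S x (x1 k) \<and> lie_deriv (pauli k) S y (y1 k)
    \<and> lie_deriv (pauli k) S d (d1 k)" if "k < 4" for k :: nat
    using lessThan_nat_cases[OF that]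
  proof (elim disjE)
    assume k: "k = 0"
    show ?thesis
      unfolding k defs ifs by (intro conjI D)
  next
    assume k: "k = 1"
    show ?thesis
      unfolding k defs ifs by (intro conjI D)
  next
    assume k: "k = 2"
    show ?thesis
      unfolding k defs ifs by (intro conjI D)
  next
    assume k: "k = 3"
    show ?thesis
      unfolding k defs ifs by (intro conjI D)
  qed
  have second: "lie_deriv (pauli k) S (x1 k) (x2 k) \<and> lie_deriv (pauli k) S (y1 k) (y2 k)
    \<and> lie_deriv (pauli k) S (d1 k) (d2 k)" if "k < 4" for k :: nat
    using lessThan_nat_cases[OF that]
  proof (elim disjE)
    assume k: "k = 0"
    show ?thesis
      unfolding k defs ifs
      by (intro conjI; (rule lie_deriv_cong, (rule R)+, simp add: s algebra_simps))
  next
    assume k: "k = 1"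
    show ?thesis
      unfolding k defs ifs
      by (intro conjI; (rule lie_deriv_cong, (rule R)+, simp add: s algebra_simps))
  next
    assume k: "k = 2"
    show ?thesis
      unfolding k defs ifs
      by (intro conjI; (rule lie_deriv_cong, (rule R)+, simp add: s algebra_simps))
  next
    assume k: "k = 3"
    show ?thesis
      unfolding k defs ifs by (intro conjI lie_deriv_const)
  qed
  define F where "F w = A * x w + B * (x w * x w) + C * y w + E * (x w * y w) + H * d w + K * (x w * d w)" for w
  define F1 where "F1 k w = A * x1 k w + B * (2 * (x w * x1 k w)) + C * y1 k w
    + E * (x1 k w * y w + x w * y1 k w) + H * d1 k w + K * (x1 k w * d w + x w * d1 k w)" for k w
  define F2 where "F2 k w = A * x2 k w + B * (2 * (x1 k w * x1 k w + x w * x2 k w)) + C * y2 k w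
    + E * (x2 k w * y w + 2 * (x1 k w * y1 k w) + x w * y2 k w)
    + H * d2 k w + K * (x2 k w * d w + 2 * (x1 k w * d1 k w) + x w * d2 k w)" for k w
  \<comment> \<open>Basis fields are \<open>1 / sqrt 2\<close> times \<open>pauli\<close> fields, so
    second derivatives carry the factor \<open>1 / 2\<close>.\<close>
  let ?r = "of_real (1 / sqrt 2) :: complex"
  have r: "?r * ?r = 1 / 2"
    by (simp flip: of_real_mult)
  have "laplace_beltrami G g z = (\<Sum>k<n. ?r * (?r * F2 k z))"
  proof (rule G.laplace_beltrami_eq)
    show "g w = F w" if "w \<in> G \<inter> S" for w
      using g[OF that] by (simp add: F_def)
    fix k assume "k \<in> {..<n}"
    then have k: "k < 4" using n by auto
    note L = lie_deriv_second[OF first[OF k, THEN conjunct1] second[OF k, THEN conjunct1]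
      first[OF k, THEN conjunct2, THEN conjunct1] second[OF k, THEN conjunct2, THEN conjunct1]
      first[OF k, THEN conjunct2, THEN conjunct2] second[OF k, THEN conjunct2, THEN conjunct2], of A B C E H K]
    show "lie_deriv (u2_basis k) S F (\<lambda>w. ?r * F1 k w)"
      unfolding u2_basis_def F_def[abs_def] F1_def by (intro lie_deriv_scaleR L(1))
    have "lie_deriv (pauli k) S (\<lambda>w. ?r * F1 k w) (\<lambda>w. ?r * F2 k w)"
      using lie_deriv_mult[OF lie_deriv_const L(2), of ?r] unfolding F1_def F2_def by simp
    then show "lie_deriv (u2_basis k) S (\<lambda>w. ?r * F1 k w) (\<lambda>w. ?r * (?r * F2 k w))"
      unfolding u2_basis_def by (rule lie_deriv_scaleR)
  qed (use z S n in \<open>auto simp: lessThan_empty_iff\<close>)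
  also have "\<dots> = (\<Sum>k<n. 1 / 2 * F2 k z)"
    by (simp only: mult.assoc[symmetric] r)
  also have "\<dots> = 1 / 2 * (F2 0 z + F2 1 z + F2 2 z)"
  proof -
    have sum3: "{..<3} = {0, 1, 2 :: nat}" "{..<4} = {0, 1, 2, 3 :: nat}"
      by auto
    have "F2 3 z = 0"
      by (simp add: F2_def x1_def x2_def y1_def y2_def d1_def d2_def)
    then show ?thesis
      using n by (auto simp: sum3 algebra_simps)
  qed
  also have "\<dots> = (2 * C + 4 * E * x z) * d z"
    by (simp add: F2_def x1_def x2_def y1_def y2_def d1_def d2_def)
      (simp add: d_def s algebra_simps)
  finally show ?thesis .
qed

text \<open>The numerator is \<open>det w\<close> up to sign. This makes the biharmonic functions
  proper.\<close>

lemma d_nonzero: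
  assumes "w \<in> unitary_group" "w \<in> S"
  shows "d w \<noteq> 0"
proof -
  have "d w = (lin 1 0 j w * lin t 1 l w - lin 1 0 l w * lin t 1 j w) / (lin t 1 j w)\<^sup>2"
    using nz[OF assms(2)] unfolding d_def x_def y_def m_def
    by (simp add: ratio_def power2_eq_square field_simps)
  also have "lin 1 0 j w * lin t 1 l w - lin 1 0 l w * lin t 1 j w = sgn2 j * det w"
    using neq_2_cases[OF jl] by (auto simp: lin_def sgn2_def det_2 algebra_simps)
  finally show ?thesis
    using det_unitary_nonzero[OF assms(1)] nz[OF assms(2)] sgn2_square[of j] by auto
qed

text \<open>By \<open>CE\<close> exactly one of \<open>C\<close>, \<open>E\<close> is nonzero, so
  the Laplacian is a nonzero multiple of \<open>d\<close> or of \<open>x d\<close>; a point with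
  \<open>x\<close> nonzero serves both cases.\<close>

lemma biharmonic_rational:
  assumes G: "unitary_matrix_group_basis G {..<n} u2_basis" and n: "n = 3 \<or> n = 4"
    and S: "open S"
    and f: "\<And>w. w \<in> G \<inter> S \<Longrightarrow>
      f w = A * x w + B * (x w * x w) + C * y w + E * (x w * y w) + H * d w"
    and CE: "C = 0 \<longleftrightarrow> E \<noteq> 0" and ex: "\<exists>w \<in> G \<inter> S. x w \<noteq> 0"
  shows "\<forall>z\<in>G \<inter> S. (laplace_beltrami G ^^ 2) f z = 0" "\<exists>z\<in>G \<inter> S. laplace_beltrami G f z \<noteq> 0"
proof -
  have L: "laplace_beltrami G f z = (2 * C + 4 * E * x z) * d z" if "z \<in> G \<inter> S" for z
    using laplace_beltrami_rational[OF G n S that, of f A B C E H 0] f by simp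
  \<comment> \<open>The Laplacian of \<open>f\<close> is again such a combination, with coefficients
    \<open>2 * C\<close> at \<open>d\<close> and \<open>4 * E\<close> at \<open>x d\<close> and
    without terms in \<open>y\<close>.\<close>
  have "laplace_beltrami G (laplace_beltrami G f) z = 0" if "z \<in> G \<inter> S" for z
    using laplace_beltrami_rational[OF G n S that, of "laplace_beltrami G f" 0 0 0 0 "2 * C" "4 * E"]
    by (simp add: L algebra_simps)
  then show "\<forall>z\<in>G \<inter> S. (laplace_beltrami G ^^ 2) f z = 0"
    by (simp add: numeral_2_eq_2)
  obtain w where w: "w \<in> G \<inter> S" "x w \<noteq> 0"
    using ex by blast
  interpret G: unitary_matrix_group_basis G "{..<n}" u2_basis by (rule G)
  have "d w \<noteq> 0"
    using w G.unitary by (intro d_nonzero) auto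
  then have "laplace_beltrami G f w \<noteq> 0"
    using L[OF w(1)] CE w(2) by auto
  then show "\<exists>z\<in>G \<inter> S. laplace_beltrami G f z \<noteq> 0"
    using w(1) by blast
qed

end

section \<open>Points where no entry of the row vanishes\<close>

lemma lin_rot:
  "lin a b 1 (z ** rot (pauli 1) \<theta>) = of_real (cos \<theta>) * lin a b 1 z - of_real (sin \<theta>) * lin a b 2 z"
  "lin a b 2 (z ** rot (pauli 1) \<theta>) = of_real (cos \<theta>) * lin a b 2 z + of_real (sin \<theta>) * lin a b 1 z"
  by (simp_all add: lin_def rot_def pauli_def matrix_matrix_mult_def mat_def sum_2
      scaleR_conv_of_real[where 'a = complex] algebra_simps)

text \<open>The forms do not vanish together, since \<open>det z\<close> is nonzero. If one
  vanishes, the rotation turns both into nonzero multiples of the other; \<open>\<theta> < 1\<close>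
  keeps \<open>sin\<close> and \<open>cos\<close> positive.\<close>

lemma lin_rot_nonzero:
  assumes z: "z \<in> unitary_group" and zero: "lin t 1 1 z * lin t 1 2 z = 0"
    and \<theta>: "0 < \<theta>" "\<theta> < 1"
  shows "lin t 1 1 (z ** rot (pauli 1) \<theta>) \<noteq> 0" "lin t 1 2 (z ** rot (pauli 1) \<theta>) \<noteq> 0"
proof -
  have "z $ 1 $ 1 * lin t 1 2 z - z $ 1 $ 2 * lin t 1 1 z = det z"
    by (simp add: lin_def det_2 algebra_simps)
  then have "\<not> (lin t 1 1 z = 0 \<and> lin t 1 2 z = 0)"
    using det_unitary_nonzero[OF z] by auto
  moreover have "sin \<theta> > 0" "cos \<theta> > 0"
    using \<theta> pi_gt3 by (auto intro!: sin_gt_zero cos_gt_zero_pi)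
  ultimately show "lin t 1 1 (z ** rot (pauli 1) \<theta>) \<noteq> 0" "lin t 1 2 (z ** rot (pauli 1) \<theta>) \<noteq> 0"
    using zero unfolding lin_rot by auto
qed

lemma exists_lin_nonzero:
  "\<exists>z\<in>special_unitary_group. lin t 1 1 z \<noteq> 0 \<and> lin t 1 2 z \<noteq> 0"
proof (cases "lin t 1 1 (mat 1) * lin t 1 2 (mat 1) = 0")
  case True
  \<comment> \<open>Any angle strictly between 0 and 1 would do.\<close>
  have "rot (pauli 1) (1/2) \<in> special_unitary_group"
    by (rule rot_pauli_special) simp
  moreover have "lin t 1 1 (mat 1 ** rot (pauli 1) (1/2)) \<noteq> 0" "lin t 1 2 (mat 1 ** rot (pauli 1) (1/2)) \<noteq> 0"
    by (rule lin_rot_nonzero[OF mat_1_unitary True]; simp)+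
  ultimately show ?thesis
    by auto
next
  case False
  then show ?thesis
    using SU.one_closed by auto
qed

text \<open>A unitary \<open>z\<close> at which a form vanishes is the limit of its rotations by
  small positive angles, where neither form vanishes.\<close>

lemma closure_lin_nonzero:
  assumes "\<And>z. z \<in> unitary_group \<Longrightarrow> lin t 1 1 z \<noteq> 0 \<Longrightarrow> lin t 1 2 z \<noteq> 0 \<Longrightarrow> z \<in> W"
  shows "unitary_group \<subseteq> closure W"
proof
  fix z :: "complex^2^2" assume z: "z \<in> unitary_group"
  show "z \<in> closure W"
  proof (cases "lin t 1 1 z * lin t 1 2 z = 0")
    case True
    have "continuous_on UNIV (\<lambda>\<theta>. z ** rot (pauli 1) \<theta>)"
      unfolding rot_def by (intro matrix_mult.continuous_on continuous_intros)
    then have "isCont (\<lambda>\<theta>. z ** rot (pauli 1) \<theta>) 0"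
      by (simp add: continuous_on_eq_continuous_at)
    then have "((\<lambda>\<theta>. z ** rot (pauli 1) \<theta>) \<longlongrightarrow> z) (at_right 0)"
      by (simp add: isCont_def rot_def filterlim_at_split)
    moreover have "\<forall>\<^sub>F \<theta> in at_right 0. z ** rot (pauli 1) \<theta> \<in> W"
    proof -
      have "\<forall>\<^sub>F \<theta> in at_right 0. (0::real) < \<theta> \<and> \<theta> < 1"
        by (auto simp: eventually_at_right_field intro!: exI[of _ 1])
      then show ?thesis
      proof (rule eventually_mono)
        fix \<theta> :: real assume "0 < \<theta> \<and> \<theta> < 1"
        then show "z ** rot (pauli 1) \<theta> \<in> W"
          using lin_rot_nonzero[OF z True, of \<theta>] z
          by (intro assms unitary_mult rot_unitary adj_pauli pauli_square) auto
      qed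
    qed
    then have "\<forall>\<^sub>F \<theta> in at_right 0. z ** rot (pauli 1) \<theta> \<in> closure W"
      by (rule eventually_mono) (use closure_subset in blast)
    ultimately show ?thesis
      by (intro Lim_in_closed_set[OF closed_closure]) auto
  next
    case False
    then show ?thesis
      using assms[OF z] closure_subset by auto
  qed
qed

section \<open>Normal form of the quotient\<close>

lemma Ck_on_entry: "Ck_on k (\<lambda>z :: complex^'n^'m. z $ i $ j) S"
  by (intro Ck_on_bounded_linear bounded_linear_compose[OF bounded_linear_vec_nth bounded_linear_vec_nth])

lemma Ck_on_pi2: "Ck_on k (\<lambda>z. pi2 z $ i $ j) S"
  using exhaust_3[of i] exhaust_3[of j] unfolding pi2_def power2_eq_square
  by (elim disjE) (simp_all; intro Ck_on_add Ck_on_mult Ck_on_const Ck_on_entry)+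

lemma Ck_on_pi2_sum: "Ck_on k (\<lambda>z. \<Sum>i\<in>UNIV. p $ i * pi2 z $ i $ j) S"
  unfolding sum_3 by (intro Ck_on_add Ck_on_mult Ck_on_const Ck_on_pi2)

text \<open>\<open>pi2 z\<close> is the symmetric square of \<open>z\<close> and
  \<open>(t^2, t, 1)\<close> that of the row \<open>(t, 1)\<close>, so the result is the symmetric
  square of the row \<open>(t, 1) z\<close>.\<close>

lemma pi2_square:
  "t\<^sup>2 * pi2 z $ 1 $ 1 + t * pi2 z $ 2 $ 1 + pi2 z $ 3 $ 1 = lin t 1 1 z * lin t 1 1 z"
  "t\<^sup>2 * pi2 z $ 1 $ 2 + t * pi2 z $ 2 $ 2 + pi2 z $ 3 $ 2 = lin t 1 1 z * lin t 1 2 z"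
  "t\<^sup>2 * pi2 z $ 1 $ 3 + t * pi2 z $ 2 $ 3 + pi2 z $ 3 $ 3 = lin t 1 2 z * lin t 1 2 z"
  by (simp_all add: pi2_def lin_def algebra_simps power2_eq_square)

text \<open>These are the derivatives of \<open>pi2_square\<close> in \<open>t\<close>, as
  \<open>lin t 1 j\<close> has derivative \<open>lin 1 0 j\<close>.\<close>

lemma pi2_polar:
  "2 * t * pi2 z $ 1 $ 1 + pi2 z $ 2 $ 1 = 2 * lin 1 0 1 z * lin t 1 1 z"
  "2 * t * pi2 z $ 1 $ 2 + pi2 z $ 2 $ 2 = lin 1 0 1 z * lin t 1 2 z + lin 1 0 2 z * lin t 1 1 z"
  "2 * t * pi2 z $ 1 $ 3 + pi2 z $ 2 $ 3 = 2 * lin 1 0 2 z * lin t 1 2 z"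
  by (simp_all add: pi2_def lin_def algebra_simps power2_eq_square)

text \<open>\<open>j\<close> is the column whose form stays in the denominator, \<open>l\<close> the
  other one. For \<open>\<beta> = 2\<close> one factor of \<open>Q\<close> cancels against
  \<open>P\<close>.\<close>

lemma quotient_normal_form:
  fixes \<alpha> \<beta> :: 3
  assumes P: "\<And>z. P z = p * (t\<^sup>2 * pi2 z $ 1 $ \<alpha> + t * pi2 z $ 2 $ \<alpha> + pi2 z $ 3 $ \<alpha>)
      + c * (2 * t * pi2 z $ 1 $ \<alpha> + pi2 z $ 2 $ \<alpha>)"
    and Q: "\<And>z. Q z = q * (t\<^sup>2 * pi2 z $ 1 $ \<beta> + t * pi2 z $ 2 $ \<beta> + pi2 z $ 3 $ \<beta>)"
    and "q \<noteq> 0" "c \<noteq> 0" "\<alpha> \<noteq> \<beta>"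
  obtains j l :: 2 and A B C E H where "j \<noteq> l" "C = 0 \<longleftrightarrow> E \<noteq> 0"
    "\<And>z. Q z \<noteq> 0 \<Longrightarrow> lin t 1 j z \<noteq> 0"
    "\<And>z. lin t 1 1 z \<noteq> 0 \<Longrightarrow> lin t 1 2 z \<noteq> 0 \<Longrightarrow> Q z \<noteq> 0"
    "\<And>z. Q z \<noteq> 0 \<Longrightarrow> P z / Q z = A * ratio t t 1 j l z + B * (ratio t t 1 j l z * ratio t t 1 j l z)
      + C * ratio t 1 0 j l z + E * (ratio t t 1 j l z * ratio t 1 0 j l z)
      + H * (ratio t 1 0 j j z * ratio t t 1 j l z - ratio t 1 0 j l z)"
proof -
  consider "\<beta> = 1" "\<alpha> = 2" | "\<beta> = 1" "\<alpha> = 3" | "\<beta> = 2" "\<alpha> = 1" | "\<beta> = 2" "\<alpha> = 3"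
    | "\<beta> = 3" "\<alpha> = 1" | "\<beta> = 3" "\<alpha> = 2"
    using exhaust_3[of \<alpha>] exhaust_3[of \<beta>] \<open>\<alpha> \<noteq> \<beta>\<close> by metis
  then show thesis
  proof cases
    case 1
    note PQ = P[unfolded 1 pi2_square pi2_polar] Q[unfolded 1 pi2_square]
    show thesis
      \<comment> \<open>The values are listed in the order \<open>j l C E A B H\<close> in which the
        variables appear in \<open>that\<close>. Here \<open>a v + b u = (a v - b u) + 2 b u\<close>
        yields \<open>C = 2 * c / q\<close> and \<open>H = c / q\<close>.\<close>
      by (rule that[of 1 2 "2 * c / q" 0 "p / q" 0 "c / q"])
        (use \<open>q \<noteq> 0\<close> \<open>c \<noteq> 0\<close> in \<open>auto simp: PQ ratio_def field_simps\<close>)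
  next
    case 2
    note PQ = P[unfolded 2 pi2_square pi2_polar] Q[unfolded 2 pi2_square]
    show thesis
      by (rule that[of 1 2 0 "2 * c / q" 0 "p / q" 0])
        (use \<open>q \<noteq> 0\<close> \<open>c \<noteq> 0\<close> in \<open>auto simp: PQ ratio_def field_simps\<close>)
  next
    case 3
    note PQ = P[unfolded 3 pi2_square pi2_polar] Q[unfolded 3 pi2_square]
    show thesis
      by (rule that[of 2 1 "2 * c / q" 0 "p / q" 0 0])
        (use \<open>q \<noteq> 0\<close> \<open>c \<noteq> 0\<close> in \<open>auto simp: PQ ratio_def field_simps\<close>)
  next
    case 4
    note PQ = P[unfolded 4 pi2_square pi2_polar] Q[unfolded 4 pi2_square]
    show thesis
      by (rule that[of 1 2 "2 * c / q" 0 "p / q" 0 0])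
        (use \<open>q \<noteq> 0\<close> \<open>c \<noteq> 0\<close> in \<open>auto simp: PQ ratio_def field_simps\<close>)
  next
    case 5
    note PQ = P[unfolded 5 pi2_square pi2_polar] Q[unfolded 5 pi2_square]
    show thesis
      by (rule that[of 2 1 0 "2 * c / q" 0 "p / q" 0])
        (use \<open>q \<noteq> 0\<close> \<open>c \<noteq> 0\<close> in \<open>auto simp: PQ ratio_def field_simps\<close>)
  next
    case 6
    note PQ = P[unfolded 6 pi2_square pi2_polar] Q[unfolded 6 pi2_square]
    show thesis
      by (rule that[of 2 1 "2 * c / q" 0 "p / q" 0 "c / q"])
        (use \<open>q \<noteq> 0\<close> \<open>c \<noteq> 0\<close> in \<open>auto simp: PQ ratio_def field_simps\<close>)
  qed
qed

theorem theorem5p1: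
  fixes \<alpha> \<beta> :: 3 and p q :: "complex^3"
    and P Q f :: "complex^2^2 \<Rightarrow> complex" and W :: "(complex^2^2) set"
  assumes P: "P = (\<lambda>z. \<Sum>j\<in>UNIV. p $ j * pi2 z $ j $ \<alpha>)"
    and Q: "Q = (\<lambda>z. \<Sum>k\<in>UNIV. q $ k * pi2 z $ k $ \<beta>)"
    and f: "f = (\<lambda>z. P z / Q z)"
    and W: "W = {z \<in> unitary_group. Q z \<noteq> 0}"
    and "\<alpha> \<noteq> \<beta>"
    and "p $ 2 * q $ 3 - p $ 3 * q $ 2 \<noteq> 0"
    and "p $ 1 * (q $ 3)\<^sup>2 = q $ 2 * (2 * p $ 2 * q $ 3 - p $ 3 * q $ 2)"
    and "q $ 1 * q $ 3 = (q $ 2)\<^sup>2"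
  shows "openin (top_of_set unitary_group) W \<and> unitary_group \<subseteq> closure W
    \<and> proper_biharmonic_on unitary_group W f
    \<and> proper_biharmonic_on special_unitary_group (W \<inter> special_unitary_group) f"
proof -
  \<comment> \<open>\<open>q $ 3 = 0\<close> would force \<open>q $ 2 = 0\<close>, against
    \<open>assms(6)\<close>.\<close>
  have q3: "q $ 3 \<noteq> 0"
    using assms(6,8) by auto
  define t where "t = q $ 2 / q $ 3"
  define c where "c = p $ 2 - p $ 3 * t"
  have c: "c \<noteq> 0"
    using assms(6) q3 by (auto simp: c_def t_def field_simps)
  have q_eq: "q $ 2 = q $ 3 * t" "q $ 1 = q $ 3 * t\<^sup>2"
    using q3 assms(8) by (auto simp: t_def power2_eq_square field_simps)
  have p2: "p $ 2 = p $ 3 * t + c"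
    by (simp add: c_def)
  \<comment> \<open>The condition on \<open>p $ 1\<close> says that \<open>p\<close> differs from
    \<open>p $ 3\<close> times \<open>(t^2, t, 1)\<close> by \<open>c\<close> times the tangent
    vector \<open>(2 t, 1, 0)\<close> of that curve.\<close>
  have "p $ 1 * (q $ 3)\<^sup>2 = (p $ 3 * t\<^sup>2 + c * (2 * t)) * (q $ 3)\<^sup>2"
    unfolding assms(7) p2 q_eq by (simp add: power2_eq_square algebra_simps)
  then have p1: "p $ 1 = p $ 3 * t\<^sup>2 + c * (2 * t)"
    using q3 by simp
  have P_eq: "P z = p $ 3 * (t\<^sup>2 * pi2 z $ 1 $ \<alpha> + t * pi2 z $ 2 $ \<alpha> + pi2 z $ 3 $ \<alpha>)
      + c * (2 * t * pi2 z $ 1 $ \<alpha> + pi2 z $ 2 $ \<alpha>)" for z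
    unfolding P sum_3 p1 p2 by (simp add: algebra_simps)
  have Q_eq: "Q z = q $ 3 * (t\<^sup>2 * pi2 z $ 1 $ \<beta> + t * pi2 z $ 2 $ \<beta> + pi2 z $ 3 $ \<beta>)" for z
    unfolding Q sum_3 q_eq by (simp add: algebra_simps)
  obtain j l :: 2 and A B C E H where jl: "j \<noteq> l" and CE: "C = 0 \<longleftrightarrow> E \<noteq> 0"
    and nz: "\<And>z. Q z \<noteq> 0 \<Longrightarrow> lin t 1 j z \<noteq> 0"
    and Q_nz: "\<And>z. lin t 1 1 z \<noteq> 0 \<Longrightarrow> lin t 1 2 z \<noteq> 0 \<Longrightarrow> Q z \<noteq> 0"
    and f_eq: "\<And>z. Q z \<noteq> 0 \<Longrightarrow> P z / Q z = A * ratio t t 1 j l z + B * (ratio t t 1 j l z * ratio t t 1 j l z)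
      + C * ratio t 1 0 j l z + E * (ratio t t 1 j l z * ratio t 1 0 j l z)
      + H * (ratio t 1 0 j j z * ratio t t 1 j l z - ratio t 1 0 j l z)"
    by (rule quotient_normal_form[OF P_eq Q_eq q3 c assms(5)]) (rule that)
  define S where "S = {z. Q z \<noteq> 0}"
  have "continuous_on UNIV Q"
    using Ck_on_pi2_sum[of 0 q \<beta> UNIV] by (simp add: Q)
  then have S: "open S"
    unfolding S_def by (intro open_Collect_neq continuous_on_const)
  have WS: "W = unitary_group \<inter> S" "W \<inter> special_unitary_group = special_unitary_group \<inter> S"
    by (auto simp: W S_def special_unitary_group_def)
  have Ck: "Ck_on k f S" for k
    unfolding f divide_inverse P Q
    by (intro Ck_on_mult Ck_on_inverse Ck_on_pi2_sum) (simp add: S_def Q)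
  \<comment> \<open>One argument for both groups: each contains SU(2), where the point with no
    vanishing form is found.\<close>
  have "proper_biharmonic_on G (G \<inter> S) f"
    if G: "unitary_matrix_group_basis G {..<n} u2_basis" "n = 3 \<or> n = 4"
      and sub: "special_unitary_group \<subseteq> G" for G n
  proof -
    obtain w where w: "w \<in> special_unitary_group" "lin t 1 1 w \<noteq> 0" "lin t 1 2 w \<noteq> 0"
      using exists_lin_nonzero by blast
    have "ratio t t 1 j l w \<noteq> 0"
      using w neq_2_cases[OF jl] by (auto simp: ratio_def)
    then have "\<exists>w \<in> G \<inter> S. ratio t t 1 j l w \<noteq> 0"
      using w Q_nz sub by (auto simp: S_def)
    note LB = biharmonic_rational[OF jl nz G S _ CE this, of f A B H]
    have "smooth_fun_on (G \<inter> S) f"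
      unfolding smooth_fun_on_def using S Ck by blast
    then show ?thesis
      unfolding proper_biharmonic_on_def
      using LB f_eq S by (auto simp: S_def f)
  qed
  note PB = this
  show ?thesis
  proof (intro conjI)
    show "openin (top_of_set unitary_group) W"
      unfolding WS using S by (rule openin_open_Int)
    show "unitary_group \<subseteq> closure W"
      by (rule closure_lin_nonzero[of t]) (simp add: W Q_nz)
    show "proper_biharmonic_on unitary_group W f"
      unfolding WS by (rule PB[OF U2.unitary_matrix_group_basis_axioms])
        (auto simp: special_unitary_group_def)
    show "proper_biharmonic_on special_unitary_group (W \<inter> special_unitary_group) f"
      unfolding WS(2) by (rule PB[OF SU2.unitary_matrix_group_basis_axioms]) auto
  qed
qed

end
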